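(* Let $\mathfrak{n}$ be a finite-dimensional, nilpotent Lie algebra, and let $\mathfrak{g}=\mathfrak{sl}_2$ or $\mathfrak{g}=\mathfrak{sol}_2$. Then $\mathcal{F}(\mathcal{C}^\bullet(\mathfrak{n}),\mathfrak{g})=\mathcal{F}^1(\mathcal{C}^\bullet(\mathfrak{n}),\mathfrak{g})$.
   Context: Everything is over $\mathbb{C}$. $\mathfrak{sol}_2$ is the standard Borel subalgebra of $\mathfrak{sl}_2$. $\mathcal{C}^\bullet(\mathfrak{n})=(\bigwedge^\bullet\mathfrak{n}^*,d)$ is the Chevalley–Eilenberg cochain algebra, a commutative differential graded algebra (cdga), with $d\colon\mathfrak{n}^*\to\mathfrak{n}^*\wedge\mathfrak{n}^*$ equal to minus the dual of the Lie bracket, extended by the graded Leibniz rule. For a cdga $A$ with $A^0=\mathbb{C}\cdot 1$ and a Lie algebra $\mathfrak{g}$, $A\otimes\mathfrak{g}$ has bracket $[\alpha\otimes x,\beta\otimes y]=\alpha\beta\otimes[x,y]$ and differential $\partial(\alpha\otimes x)=d\alpha\otimes x$; the set of flat connections is $\mathcal{F}(A,\mathfrak{g})=\{\omega\in A^1\otimes\mathfrak{g}\mid\partial\omega+\frac12[\omega,\omega]=0\}$. $\mathcal{F}^1(A,\mathfrak{g})\subseteq\mathcal{F}(A,\mathfrak{g})$ is the set of all tensors $\eta\otimes g$ with $\eta\in A^1$, $d\eta=0$, $g\in\mathfrak{g}$. *)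

theory Defs
  imports "HOL-Analysis.Analysis" "HOL-Library.Poly_Mapping"
begin

section \<open>Complex vector spaces and Lie algebras\<close>

class complex_vector = ab_group_add +
  fixes scaleC :: "complex \<Rightarrow> 'a \<Rightarrow> 'a"  (infixr "*\<^sub>C" 75)
  assumes scaleC_add_right: "a *\<^sub>C (x + y) = a *\<^sub>C x + a *\<^sub>C y"
    and scaleC_add_left: "(a + b) *\<^sub>C x = a *\<^sub>C x + b *\<^sub>C x"
    and scaleC_scaleC: "a *\<^sub>C b *\<^sub>C x = (a * b) *\<^sub>C x"
    and scaleC_one: "1 *\<^sub>C x = x"

global_interpretation complex_vector:
  vector_space "scaleC :: complex \<Rightarrow> 'a \<Rightarrow> 'a :: complex_vector"
  by unfold_locales (auto simp: scaleC_add_right scaleC_add_left scaleC_scaleC scaleC_one)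

abbreviation clinear :: "('a::complex_vector \<Rightarrow> 'b::complex_vector) \<Rightarrow> bool"
  where "clinear \<equiv> Vector_Spaces.linear scaleC scaleC"

lemma clinearI:
  assumes "\<And>x y. f (x + y) = f x + f y" "\<And>c x. f (c *\<^sub>C x) = c *\<^sub>C f x"
  shows "clinear f"
  using assms by unfold_locales auto

lemma clinear_add: "clinear f \<Longrightarrow> f (x + y) = f x + f y"
  and clinear_scale: "clinear f \<Longrightarrow> f (c *\<^sub>C x) = c *\<^sub>C f x"
  and clinear_diff: "clinear f \<Longrightarrow> f (x - y) = f x - f y"
  by (simp add: Vector_Spaces.linear_iff, simp add: Vector_Spaces.linear_iff,
      simp add: module_hom.diff flip: module_hom_iff_linear)

definition cbilinear :: "('a::complex_vector \<Rightarrow> 'b::complex_vector \<Rightarrow> 'c::complex_vector) \<Rightarrow> bool"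
  where "cbilinear f \<longleftrightarrow> (\<forall>y. clinear (\<lambda>x. f x y)) \<and> (\<forall>x. clinear (f x))"

definition finite_dimensional :: "'a::complex_vector itself \<Rightarrow> bool"
  where "finite_dimensional _ \<longleftrightarrow> (\<exists>B :: 'a set. finite B \<and> complex_vector.span B = UNIV)"

instantiation complex :: complex_vector
begin
definition scaleC_complex :: "complex \<Rightarrow> complex \<Rightarrow> complex" where "scaleC_complex = (*)"
instance by standard (auto simp: scaleC_complex_def algebra_simps)
end

instantiation vec :: (complex_vector, finite) complex_vector
begin
definition scaleC_vec :: "complex \<Rightarrow> 'a ^ 'b \<Rightarrow> 'a ^ 'b" where "scaleC_vec c v = (\<chi> i. c *\<^sub>C v $ i)"
instance
  by standard (auto simp: scaleC_vec_def vec_eq_iff complex_vector.scale_left_distrib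
      complex_vector.scale_right_distrib)
end

class complex_lie_algebra = complex_vector +
  fixes lie_bracket :: "'a \<Rightarrow> 'a \<Rightarrow> 'a"
  assumes lie_bracket_add_left: "lie_bracket (x + y) z = lie_bracket x z + lie_bracket y z"
    and lie_bracket_scale_left: "lie_bracket (c *\<^sub>C x) z = c *\<^sub>C lie_bracket x z"
    and lie_bracket_add_right: "lie_bracket x (y + z) = lie_bracket x y + lie_bracket x z"
    and lie_bracket_scale_right: "lie_bracket x (c *\<^sub>C z) = c *\<^sub>C lie_bracket x z"
    and lie_bracket_self: "lie_bracket x x = 0"
    and lie_jacobi: "lie_bracket x (lie_bracket y z) + lie_bracket y (lie_bracket z x)
                       + lie_bracket z (lie_bracket x y) = 0"

lemma lie_bracket_swap: "lie_bracket x y = - lie_bracket y (x :: 'a :: complex_lie_algebra)"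
proof -
  have "lie_bracket (x + y) (x + y) = 0" by (rule lie_bracket_self)
  then have "lie_bracket x y + lie_bracket y x = 0"
    unfolding lie_bracket_add_left lie_bracket_add_right by (simp add: lie_bracket_self add.commute)
  then show ?thesis by (simp add: eq_neg_iff_add_eq_0)
qed

primrec lower_central_series :: "nat \<Rightarrow> 'a::complex_lie_algebra set"
  where
    "lower_central_series 0 = UNIV"
  | "lower_central_series (Suc k) =
       complex_vector.span {lie_bracket x y | x y. y \<in> lower_central_series k}"

definition nilpotent_lie_algebra :: "'a::complex_lie_algebra itself \<Rightarrow> bool"
  where "nilpotent_lie_algebra _ \<longleftrightarrow> (\<exists>k. lower_central_series k = {0 :: 'a})"


section \<open>The Lie algebra of traceless matrices of size two and its standard Borel subalgebra\<close>

definition commutator :: "'a::ring_1 ^ 'n ^ 'n \<Rightarrow> 'a ^ 'n ^ 'n \<Rightarrow> 'a ^ 'n ^ 'n"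
  where "commutator A B = A ** B - B ** A"

lemma scaleC_mat_nth: "(c *\<^sub>C (A :: complex ^ 'n ^ 'm)) $ i $ j = c * A $ i $ j"
  by (simp add: scaleC_vec_def scaleC_complex_def)

lemmas mat2_simps = commutator_def trace_def matrix_matrix_mult_def sum_2 vec_eq_iff forall_2
  scaleC_mat_nth

typedef sl2 = "{A :: complex ^ 2 ^ 2. trace A = 0}"
  by (rule exI[of _ 0]) (simp add: trace_def)

setup_lifting type_definition_sl2

instantiation sl2 :: complex_lie_algebra
begin
lift_definition zero_sl2 :: sl2 is 0 by (simp add: trace_def)
lift_definition plus_sl2 :: "sl2 \<Rightarrow> sl2 \<Rightarrow> sl2" is "(+)" by (simp add: trace_add)
lift_definition minus_sl2 :: "sl2 \<Rightarrow> sl2 \<Rightarrow> sl2" is "(-)" by (simp add: trace_sub)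
lift_definition uminus_sl2 :: "sl2 \<Rightarrow> sl2" is uminus by (simp add: trace_def sum_negf)
lift_definition scaleC_sl2 :: "complex \<Rightarrow> sl2 \<Rightarrow> sl2" is scaleC
  by (simp add: trace_def scaleC_mat_nth flip: sum_distrib_left)
lift_definition lie_bracket_sl2 :: "sl2 \<Rightarrow> sl2 \<Rightarrow> sl2" is commutator
  by (simp add: mat2_simps)
instance
  by standard (transfer; simp add: mat2_simps algebra_simps)+
end

typedef sol2 = "{A :: complex ^ 2 ^ 2. trace A = 0 \<and> A $ 2 $ 1 = 0}"
  by (rule exI[of _ 0]) (simp add: trace_def)

setup_lifting type_definition_sol2

instantiation sol2 :: complex_lie_algebra
begin
lift_definition zero_sol2 :: sol2 is 0 by (simp add: trace_def)
lift_definition plus_sol2 :: "sol2 \<Rightarrow> sol2 \<Rightarrow> sol2" is "(+)" by (simp add: trace_add)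
lift_definition minus_sol2 :: "sol2 \<Rightarrow> sol2 \<Rightarrow> sol2" is "(-)" by (simp add: trace_sub)
lift_definition uminus_sol2 :: "sol2 \<Rightarrow> sol2" is uminus by (simp add: trace_def sum_negf)
lift_definition scaleC_sol2 :: "complex \<Rightarrow> sol2 \<Rightarrow> sol2" is scaleC
  by (simp add: trace_def scaleC_mat_nth flip: sum_distrib_left)
lift_definition lie_bracket_sol2 :: "sol2 \<Rightarrow> sol2 \<Rightarrow> sol2" is commutator
  by (simp add: mat2_simps)
instance
  by standard (transfer; simp add: mat2_simps algebra_simps)+
end


section \<open>Tensor products of complex vector spaces\<close>

instantiation poly_mapping :: (type, complex_vector) complex_vector
begin
lift_definition scaleC_poly_mapping :: "complex \<Rightarrow> ('a \<Rightarrow>\<^sub>0 'b) \<Rightarrow> 'a \<Rightarrow>\<^sub>0 'b"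
  is "\<lambda>c f k. c *\<^sub>C f k"
  by (erule rev_finite_subset) auto
instance
  by standard (transfer; simp add: fun_eq_iff complex_vector.scale_left_distrib
      complex_vector.scale_right_distrib)+
end

text \<open>
  \<^term>\<open>Poly_Mapping.single (x, y) 1\<close> is the basis vector indexed by \<^term>\<open>(x, y)\<close> of the free
  vector space on the set of all pairs.
\<close>

definition tensor_relators :: "(('a::complex_vector \<times> 'b::complex_vector) \<Rightarrow>\<^sub>0 complex) set"
  where "tensor_relators =
     {Poly_Mapping.single (x + x', y) 1 - Poly_Mapping.single (x, y) 1
        - Poly_Mapping.single (x', y) 1 | x x' y. True}
   \<union> {Poly_Mapping.single (x, y + y') 1 - Poly_Mapping.single (x, y) 1
        - Poly_Mapping.single (x, y') 1 | x y y'. True}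
   \<union> {Poly_Mapping.single (c *\<^sub>C x, y) 1 - c *\<^sub>C Poly_Mapping.single (x, y) 1 | c x y. True}
   \<union> {Poly_Mapping.single (x, c *\<^sub>C y) 1 - c *\<^sub>C Poly_Mapping.single (x, y) 1 | c x y. True}"

quotient_type (overloaded) ('a, 'b) tensor =
  "('a::complex_vector \<times> 'b::complex_vector) \<Rightarrow>\<^sub>0 complex" /
  "\<lambda>p q. p - q \<in> complex_vector.span tensor_relators"
proof (rule equivpI)
  show "reflp (\<lambda>p q. p - q \<in> complex_vector.span tensor_relators)"
    by (rule reflpI) (simp add: complex_vector.span_zero)
  show "symp (\<lambda>p q. p - q \<in> complex_vector.span tensor_relators)"
    by (rule sympI) (drule complex_vector.span_neg, simp)
  show "transp (\<lambda>p q. p - q \<in> complex_vector.span tensor_relators)"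
    by (rule transpI) (drule (1) complex_vector.span_add, simp)
qed

instantiation tensor :: (complex_vector, complex_vector) complex_vector
begin
lift_definition zero_tensor :: "('a, 'b) tensor" is 0 .
lift_definition plus_tensor :: "('a, 'b) tensor \<Rightarrow> ('a, 'b) tensor \<Rightarrow> ('a, 'b) tensor" is "(+)"
  by (drule (1) complex_vector.span_add) (simp add: algebra_simps)
lift_definition minus_tensor :: "('a, 'b) tensor \<Rightarrow> ('a, 'b) tensor \<Rightarrow> ('a, 'b) tensor" is "(-)"
  by (drule (1) complex_vector.span_diff) (simp add: algebra_simps)
lift_definition uminus_tensor :: "('a, 'b) tensor \<Rightarrow> ('a, 'b) tensor" is uminus
  by (drule complex_vector.span_neg) simp
lift_definition scaleC_tensor :: "complex \<Rightarrow> ('a, 'b) tensor \<Rightarrow> ('a, 'b) tensor" is scaleC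
  by (drule complex_vector.span_scale) (simp add: complex_vector.scale_right_diff_distrib)
instance
  by standard (transfer; simp add: complex_vector.span_zero complex_vector.scale_left_distrib
      complex_vector.scale_right_distrib)+
end

lift_definition tensor :: "'a::complex_vector \<Rightarrow> 'b::complex_vector \<Rightarrow> ('a, 'b) tensor"
    (infixr "\<otimes>" 70)
  is "\<lambda>x y. Poly_Mapping.single (x, y) 1" .

lemma tensor_add_left: "(x + x') \<otimes> y = x \<otimes> y + x' \<otimes> y"
  by transfer (rule complex_vector.span_base, unfold tensor_relators_def diff_diff_add[symmetric], blast)

lemma tensor_add_right: "x \<otimes> (y + y') = x \<otimes> y + x \<otimes> y'"
  by transfer (rule complex_vector.span_base, unfold tensor_relators_def diff_diff_add[symmetric], blast)

lemma tensor_scale_left: "(c *\<^sub>C x) \<otimes> y = c *\<^sub>C (x \<otimes> y)"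
  by transfer (rule complex_vector.span_base, unfold tensor_relators_def, blast)

lemma tensor_scale_right: "x \<otimes> (c *\<^sub>C y) = c *\<^sub>C (x \<otimes> y)"
  by transfer (rule complex_vector.span_base, unfold tensor_relators_def, blast)

lemma cbilinear_tensor: "cbilinear (\<otimes>)"
  unfolding cbilinear_def
  by (simp add: clinearI tensor_add_left tensor_add_right tensor_scale_left tensor_scale_right)

definition free_extension :: "('k \<Rightarrow> 'c::complex_vector) \<Rightarrow> ('k \<Rightarrow>\<^sub>0 complex) \<Rightarrow> 'c"
  where "free_extension f p = (\<Sum>k\<in>Poly_Mapping.keys p. Poly_Mapping.lookup p k *\<^sub>C f k)"

lemma free_extension_superset:
  assumes "finite K" "Poly_Mapping.keys p \<subseteq> K"
  shows "free_extension f p = (\<Sum>k\<in>K. Poly_Mapping.lookup p k *\<^sub>C f k)"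
  unfolding free_extension_def using assms
  by (intro sum.mono_neutral_left) (auto simp: in_keys_iff)

lemma clinear_free_extension: "clinear (free_extension f)"
proof (rule clinearI)
  fix p q :: "'a \<Rightarrow>\<^sub>0 complex" and c
  let ?K = "Poly_Mapping.keys p \<union> Poly_Mapping.keys q"
  show "free_extension f (p + q) = free_extension f p + free_extension f q"
    by (simp add: free_extension_superset[of ?K] Poly_Mapping.keys_add lookup_add
        complex_vector.scale_left_distrib sum.distrib)
  have "free_extension f (c *\<^sub>C p)
      = (\<Sum>k\<in>Poly_Mapping.keys p. Poly_Mapping.lookup (c *\<^sub>C p) k *\<^sub>C f k)"
    by (rule free_extension_superset)
      (auto simp: in_keys_iff scaleC_poly_mapping.rep_eq scaleC_complex_def)
  then show "free_extension f (c *\<^sub>C p) = c *\<^sub>C free_extension f p"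
    by (simp add: free_extension_def scaleC_poly_mapping.rep_eq scaleC_complex_def
        complex_vector.scale_sum_right)
qed

lemma free_extension_single: "free_extension f (Poly_Mapping.single k c) = c *\<^sub>C f k"
  by (simp add: free_extension_def)

definition tensor_lift :: "('a::complex_vector \<Rightarrow> 'b::complex_vector \<Rightarrow> 'c::complex_vector)
    \<Rightarrow> ('a, 'b) tensor \<Rightarrow> 'c"
  where "tensor_lift f t = free_extension (case_prod f) (rep_tensor t)"

lemma free_extension_relators:
  assumes f: "cbilinear f" and p: "p \<in> complex_vector.span tensor_relators"
  shows "free_extension (case_prod f) p = 0"
proof (rule module_hom.eq_0_on_span[OF _ _ p])
  show "module_hom scaleC scaleC (free_extension (case_prod f))"
    using clinear_free_extension by (simp only: module_hom_iff_linear)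
next
  fix r assume "r \<in> (tensor_relators :: (('a \<times> 'b) \<Rightarrow>\<^sub>0 complex) set)"
  moreover have "free_extension g (q - q') = free_extension g q - free_extension g q'"
    and "free_extension g (c *\<^sub>C q) = c *\<^sub>C free_extension g q"
    for g :: "'a \<times> 'b \<Rightarrow> 'c" and q q' c
    by (simp_all add: clinear_diff[OF clinear_free_extension]
        clinear_scale[OF clinear_free_extension])
  moreover have "f (x + x') y = f x y + f x' y" "f (c *\<^sub>C x) y = c *\<^sub>C f x y"
    "f x (y + y') = f x y + f x y'" "f x (c *\<^sub>C y) = c *\<^sub>C f x y" for x x' y y' c
    using f unfolding cbilinear_def by (auto simp: Vector_Spaces.linear_iff)
  ultimately show "free_extension (case_prod f) r = 0"
    by (auto simp: tensor_relators_def free_extension_single)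
qed

lemma tensor_lift_abs:
  assumes "cbilinear f"
  shows "tensor_lift f (abs_tensor p) = free_extension (case_prod f) p"
proof -
  have "rep_tensor (abs_tensor p) - p \<in> complex_vector.span tensor_relators"
    by (rule Quotient_rep_abs[OF Quotient_tensor]) (simp add: complex_vector.span_zero)
  from free_extension_relators[OF assms this] show ?thesis
    by (simp add: tensor_lift_def clinear_diff[OF clinear_free_extension])
qed

lemma tensor_lift_tensor: "cbilinear f \<Longrightarrow> tensor_lift f (x \<otimes> y) = f x y"
  by (simp add: tensor.abs_eq tensor_lift_abs free_extension_single)

lemma tensor_abs_cases: obtains p where "t = abs_tensor p"
  by (induction t rule: tensor.abs_induct) auto

lemma clinear_tensor_lift:
  assumes "cbilinear f"
  shows "clinear (tensor_lift f)"
proof (rule clinearI)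
  fix s t :: "('a, 'b) tensor" and c
  obtain p where s: "s = abs_tensor p" by (rule tensor_abs_cases)
  obtain q where t: "t = abs_tensor q" by (rule tensor_abs_cases)
  show "tensor_lift f (s + t) = tensor_lift f s + tensor_lift f t"
    by (simp add: s t plus_tensor.abs_eq tensor_lift_abs assms clinear_add[OF clinear_free_extension])
  show "tensor_lift f (c *\<^sub>C s) = c *\<^sub>C tensor_lift f s"
    by (simp add: s t scaleC_tensor.abs_eq tensor_lift_abs assms
        clinear_scale[OF clinear_free_extension])
qed


section \<open>Commutative differential graded algebras and flat connections\<close>

class cdga = complex_vector + ring_1 +
  fixes degree_part :: "nat \<Rightarrow> 'a set"
    and differential :: "'a \<Rightarrow> 'a"
  assumes mult_scaleC_left: "(c *\<^sub>C a) * b = c *\<^sub>C (a * b)"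
    and mult_scaleC_right: "a * (c *\<^sub>C b) = c *\<^sub>C (a * b)"
    and degree_part_zero: "0 \<in> degree_part p"
    and degree_part_add: "a \<in> degree_part p \<Longrightarrow> b \<in> degree_part p \<Longrightarrow> a + b \<in> degree_part p"
    and degree_part_scale: "a \<in> degree_part p \<Longrightarrow> c *\<^sub>C a \<in> degree_part p"
    and degree_part_generate: "\<exists>n f. (\<forall>i. f i \<in> degree_part i) \<and> a = (\<Sum>i\<le>n. f i)"
    and degree_part_independent:
      "(\<And>i. f i \<in> degree_part i) \<Longrightarrow> (\<Sum>i\<le>n. f i) = 0 \<Longrightarrow> i \<le> n \<Longrightarrow> f i = 0"
    and one_degree_part: "1 \<in> degree_part 0"
    and mult_degree_part:
      "a \<in> degree_part p \<Longrightarrow> b \<in> degree_part q \<Longrightarrow> a * b \<in> degree_part (p + q)"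
    and graded_commute:
      "a \<in> degree_part p \<Longrightarrow> b \<in> degree_part q \<Longrightarrow> a * b = (- 1) ^ (p * q) * (b * a)"
    and differential_add: "differential (a + b) = differential a + differential b"
    and differential_scale: "differential (c *\<^sub>C a) = c *\<^sub>C differential a"
    and differential_degree_part: "a \<in> degree_part p \<Longrightarrow> differential a \<in> degree_part (Suc p)"
    and graded_leibniz:
      "a \<in> degree_part p \<Longrightarrow> differential (a * b) = differential a * b + (- 1) ^ p * (a * differential b)"
    and differential_differential: "differential (differential a) = 0"

class connected_cdga = cdga +
  assumes degree_part_0: "degree_part 0 = {c *\<^sub>C 1 | c. True}"

text \<open>
  The bracket is the bilinear extension of
  $[\alpha \otimes x, \beta \otimes y] = \alpha\beta \otimes [x, y]$, extended first in the second
  and then in the first argument.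
\<close>

definition tensor_bracket_left ::
    "'a::cdga \<Rightarrow> 'g::complex_lie_algebra \<Rightarrow> ('a, 'g) tensor \<Rightarrow> ('a, 'g) tensor"
  where "tensor_bracket_left \<alpha> x = tensor_lift (\<lambda>\<beta> y. (\<alpha> * \<beta>) \<otimes> lie_bracket x y)"

definition tensor_bracket ::
    "('a::cdga, 'g::complex_lie_algebra) tensor \<Rightarrow> ('a, 'g) tensor \<Rightarrow> ('a, 'g) tensor"
  where "tensor_bracket s t = tensor_lift (\<lambda>\<alpha> x. tensor_bracket_left \<alpha> x t) s"

definition tensor_differential :: "('a::cdga, 'g::complex_lie_algebra) tensor \<Rightarrow> ('a, 'g) tensor"
  where "tensor_differential = tensor_lift (\<lambda>\<alpha> x. differential \<alpha> \<otimes> x)"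

lemma tensor_induct [case_names tensor add]:
  fixes t :: "('a::complex_vector, 'b::complex_vector) tensor"
  assumes "\<And>x y. P (x \<otimes> y)" "\<And>s t. P s \<Longrightarrow> P t \<Longrightarrow> P (s + t)"
  shows "P t"
proof -
  obtain p where t: "t = abs_tensor p"
    by (rule tensor_abs_cases)
  have "P (abs_tensor p)"
  proof (induction p rule: update_induct)
    case const
    have "abs_tensor 0 = 0 *\<^sub>C ((0 :: 'a) \<otimes> (0 :: 'b))"
      by (simp only: complex_vector.scale_zero_left zero_tensor_def)
    also have "\<dots> = (0 *\<^sub>C 0) \<otimes> 0"
      by (simp only: tensor_scale_left)
    finally have "abs_tensor 0 = (0 *\<^sub>C 0 :: 'a) \<otimes> (0 :: 'b)" .
    then show ?case using assms(1) by simp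
  next
    case (update p k c)
    obtain x y where k: "k = (x, y)" by force
    have "Poly_Mapping.update k c p = c *\<^sub>C Poly_Mapping.single k 1 + p"
      using update(1)
      by (auto intro!: poly_mapping_eqI simp: lookup_update lookup_add lookup_single
          scaleC_poly_mapping.rep_eq scaleC_complex_def in_keys_iff)
    then have "abs_tensor (Poly_Mapping.update k c p) = (c *\<^sub>C x) \<otimes> y + abs_tensor p"
      by (simp add: k tensor_scale_left flip: tensor.abs_eq scaleC_tensor.abs_eq plus_tensor.abs_eq)
    then show ?case using assms update by simp
  qed
  with t show ?thesis by simp
qed

lemma cbilinear_tensor_bracket_aux:
  "cbilinear (\<lambda>(\<beta>::'a::cdga) y. (\<alpha> * \<beta>) \<otimes> lie_bracket x (y::'g::complex_lie_algebra))"
  unfolding cbilinear_def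
  by (intro conjI allI clinearI)
    (simp_all add: distrib_left mult_scaleC_right lie_bracket_add_right lie_bracket_scale_right
      tensor_add_left tensor_add_right tensor_scale_left tensor_scale_right)

lemma tensor_bracket_left_tensor:
    "tensor_bracket_left \<alpha> x (\<beta> \<otimes> y) = (\<alpha> * \<beta>) \<otimes> lie_bracket x y"
  and clinear_tensor_bracket_left: "clinear (tensor_bracket_left \<alpha> x)"
  unfolding tensor_bracket_left_def
  by (rule tensor_lift_tensor clinear_tensor_lift; rule cbilinear_tensor_bracket_aux)+

lemma cbilinear_tensor_bracket_left:
  "cbilinear (\<lambda>(\<alpha>::'a::cdga) (x::'g::complex_lie_algebra). tensor_bracket_left \<alpha> x t)"
  unfolding cbilinear_def
proof (intro conjI allI clinearI)
  fix \<alpha> \<alpha>' :: 'a and x x' :: 'g and c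
  note simps = tensor_bracket_left_tensor clinear_add[OF clinear_tensor_bracket_left]
    distrib_right mult_scaleC_left lie_bracket_add_left lie_bracket_scale_left
    tensor_add_left tensor_add_right tensor_scale_left tensor_scale_right
    complex_vector.scale_right_distrib add_ac
  let ?B = "\<lambda>\<alpha> x. tensor_bracket_left \<alpha> x t"
  show "?B (\<alpha> + \<alpha>') x = ?B \<alpha> x + ?B \<alpha>' x"
    by (induction t rule: tensor_induct) (simp_all add: simps)
  show "?B (c *\<^sub>C \<alpha>) x = c *\<^sub>C ?B \<alpha> x"
    by (induction t rule: tensor_induct) (simp_all add: simps)
  show "?B \<alpha> (x + x') = ?B \<alpha> x + ?B \<alpha> x'"
    by (induction t rule: tensor_induct) (simp_all add: simps)
  show "?B \<alpha> (c *\<^sub>C x) = c *\<^sub>C ?B \<alpha> x"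
    by (induction t rule: tensor_induct) (simp_all add: simps)
qed

lemma tensor_bracket_tensor_left: "tensor_bracket (\<alpha> \<otimes> x) t = tensor_bracket_left \<alpha> x t"
  and clinear_tensor_bracket_first: "clinear (\<lambda>s. tensor_bracket s t)"
  unfolding tensor_bracket_def
  by (rule tensor_lift_tensor clinear_tensor_lift; rule cbilinear_tensor_bracket_left)+

lemma tensor_bracket_tensor:
  "tensor_bracket (\<alpha> \<otimes> x) (\<beta> \<otimes> y) = (\<alpha> * \<beta>) \<otimes> lie_bracket x y"
  by (simp add: tensor_bracket_tensor_left tensor_bracket_left_tensor)

lemma cbilinear_tensor_bracket: "cbilinear tensor_bracket"
  unfolding cbilinear_def
proof (intro conjI allI clinear_tensor_bracket_first clinearI)
  fix s t t' :: "('a, 'b) tensor" and c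
  note simps = tensor_bracket_tensor_left clinear_add[OF clinear_tensor_bracket_first]
    clinear_add[OF clinear_tensor_bracket_left] clinear_scale[OF clinear_tensor_bracket_left]
    complex_vector.scale_right_distrib add_ac
  show "tensor_bracket s (t + t') = tensor_bracket s t + tensor_bracket s t'"
    by (induction s rule: tensor_induct) (simp_all add: simps)
  show "tensor_bracket s (c *\<^sub>C t) = c *\<^sub>C tensor_bracket s t"
    by (induction s rule: tensor_induct) (simp_all add: simps)
qed

lemma cbilinear_tensor_differential_aux:
  "cbilinear (\<lambda>(\<alpha>::'a::cdga) (x::'g::complex_lie_algebra). differential \<alpha> \<otimes> x)"
  unfolding cbilinear_def
  by (intro conjI allI clinearI)
    (simp_all add: differential_add differential_scale
      tensor_add_left tensor_add_right tensor_scale_left tensor_scale_right)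

lemma clinear_tensor_differential: "clinear tensor_differential"
  unfolding tensor_differential_def
  by (rule clinear_tensor_lift[OF cbilinear_tensor_differential_aux])

lemma tensor_differential_tensor: "tensor_differential (\<alpha> \<otimes> x) = differential \<alpha> \<otimes> x"
  unfolding tensor_differential_def
  by (rule tensor_lift_tensor[OF cbilinear_tensor_differential_aux])

text \<open>
  $A^1 \otimes \mathfrak{g}$ is the subspace of $A \otimes \mathfrak{g}$ spanned by the tensors
  whose first factor has degree one.
\<close>

definition flat_connections ::
    "'a::connected_cdga itself \<Rightarrow> 'g::complex_lie_algebra itself \<Rightarrow> ('a, 'g) tensor set"
  where "flat_connections _ _ =
    {\<omega> \<in> complex_vector.span {\<alpha> \<otimes> x | \<alpha> x. \<alpha> \<in> degree_part 1}.
       tensor_differential \<omega> + (1 / 2) *\<^sub>C tensor_bracket \<omega> \<omega> = 0}"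

definition flat_connections1 ::
    "'a::connected_cdga itself \<Rightarrow> 'g::complex_lie_algebra itself \<Rightarrow> ('a, 'g) tensor set"
  where "flat_connections1 _ _ = {\<eta> \<otimes> g | \<eta> g. \<eta> \<in> degree_part 1 \<and> differential \<eta> = 0}"


section \<open>The Chevalley--Eilenberg algebra\<close>

text \<open>
  The exterior algebra of the dual of a finite-dimensional space $V$ is modelled by the
  alternating multilinear forms on $V$. All degrees are packed into one function on lists, whose
  restriction to lists of length $k$ is the component of degree $k$. Boundedness of the degree makes
  this the direct sum, rather than the product, of its homogeneous parts.
\<close>

definition multilinear_form :: "('v::complex_vector list \<Rightarrow> complex) \<Rightarrow> bool"
  where "multilinear_form \<omega> \<longleftrightarrow> (\<forall>xs ys. clinear (\<lambda>x. \<omega> (xs @ x # ys)))"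

definition alternating_form :: "('v::complex_vector list \<Rightarrow> complex) \<Rightarrow> bool"
  where "alternating_form \<omega> \<longleftrightarrow> multilinear_form \<omega> \<and> (\<forall>xs. \<not> distinct xs \<longrightarrow> \<omega> xs = 0)"

definition bounded_degree :: "('v list \<Rightarrow> complex) \<Rightarrow> bool"
  where "bounded_degree \<omega> \<longleftrightarrow> (\<exists>m. \<forall>xs. m \<le> length xs \<longrightarrow> \<omega> xs = 0)"

definition interior_product :: "'v \<Rightarrow> ('v list \<Rightarrow> complex) \<Rightarrow> 'v list \<Rightarrow> complex"
  where "interior_product x \<omega> xs = \<omega> (x # xs)"

definition involution :: "('v list \<Rightarrow> complex) \<Rightarrow> 'v list \<Rightarrow> complex"
  where "involution \<omega> xs = (- 1) ^ length xs * \<omega> xs"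

text \<open>
  The exterior product, normalised so that
  $(\alpha \wedge \beta)(x, y) = \alpha(x)\beta(y) - \alpha(y)\beta(x)$ in degree one. It is
  determined by its value in degree zero and the fact that each interior product $\iota_x$ is an
  antiderivation; unfolding the recursion gives the signed sum over all shuffles.
\<close>

fun wedge :: "('v list \<Rightarrow> complex) \<Rightarrow> ('v list \<Rightarrow> complex) \<Rightarrow> 'v list \<Rightarrow> complex"
  where
    "wedge \<alpha> \<beta> [] = \<alpha> [] * \<beta> []"
  | "wedge \<alpha> \<beta> (x # xs) =
       wedge (interior_product x \<alpha>) \<beta> xs + wedge (involution \<alpha>) (interior_product x \<beta>) xs"

definition lie_derivative ::
    "'n::complex_lie_algebra \<Rightarrow> ('n list \<Rightarrow> complex) \<Rightarrow> 'n list \<Rightarrow> complex"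
  where "lie_derivative x \<omega> xs = - (\<Sum>i<length xs. \<omega> (xs[i := lie_bracket x (xs ! i)]))"

text \<open>
  The differential is determined by Cartan's formula
  $\iota_x \circ d + d \circ \iota_x = L_x$. Below it is shown to be an antiderivation with
  $(d\eta)(x, y) = -\eta([x, y])$ in degree one.
\<close>

fun ce_differential :: "('n::complex_lie_algebra list \<Rightarrow> complex) \<Rightarrow> 'n list \<Rightarrow> complex"
  where
    "ce_differential \<omega> [] = 0"
  | "ce_differential \<omega> (x # xs) = lie_derivative x \<omega> xs - ce_differential (interior_product x \<omega>) xs"


subsection \<open>Alternating forms\<close>

lemma multilinear_form_add:
    "multilinear_form \<omega> \<Longrightarrow> \<omega> (xs @ (x + y) # ys) = \<omega> (xs @ x # ys) + \<omega> (xs @ y # ys)"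
  and multilinear_form_scale:
    "multilinear_form \<omega> \<Longrightarrow> \<omega> (xs @ (c *\<^sub>C x) # ys) = c * \<omega> (xs @ x # ys)"
  by (simp_all add: multilinear_form_def Vector_Spaces.linear_iff scaleC_complex_def)

lemma multilinear_formI:
  assumes "\<And>xs x y ys. \<omega> (xs @ (x + y) # ys) = \<omega> (xs @ x # ys) + \<omega> (xs @ y # ys)"
    and "\<And>xs c x ys. \<omega> (xs @ (c *\<^sub>C x) # ys) = c * \<omega> (xs @ x # ys)"
  shows "multilinear_form \<omega>"
  unfolding multilinear_form_def by (intro allI clinearI) (simp_all add: assms scaleC_complex_def)

lemma multilinear_form_zero: "multilinear_form \<omega> \<Longrightarrow> \<omega> (xs @ 0 # ys) = 0"
  using multilinear_form_scale[of \<omega> xs 0 0 ys] by simp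

lemma alternating_form_multilinear: "alternating_form \<omega> \<Longrightarrow> multilinear_form \<omega>"
  by (simp add: alternating_form_def)

lemma alternating_form_adjacent: "alternating_form \<omega> \<Longrightarrow> \<omega> (xs @ x # x # ys) = 0"
  by (simp add: alternating_form_def)

lemma alternating_formI:
  assumes ml: "multilinear_form \<omega>" and adj: "\<And>xs x ys. \<omega> (xs @ x # x # ys) = 0"
  shows "alternating_form \<omega>"
proof -
  have swap: "\<omega> (xs @ x # y # ys) = - \<omega> (xs @ y # x # ys)" for xs x y ys
  proof -
    have "\<omega> (xs @ (x + y) # (x + y) # ys) = 0" by (rule adj)
    then have "\<omega> (xs @ x # y # ys) + \<omega> (xs @ y # x # ys) = 0"
      using multilinear_form_add[OF ml, of xs x y "(x + y) # ys"]
        multilinear_form_add[OF ml, of "xs @ [x]" x y ys]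
        multilinear_form_add[OF ml, of "xs @ [y]" x y ys]
      by (simp add: adj)
    then show ?thesis by (simp add: eq_neg_iff_add_eq_0)
  qed
  have "\<omega> (xs @ x # ys @ x # zs) = 0" for xs x ys zs
  proof (induction ys arbitrary: xs)
    case Nil
    then show ?case by (simp add: adj)
  next
    case (Cons y ys)
    from Cons[of "xs @ [y]"] show ?case by (simp add: swap[of xs x y])
  qed
  then show ?thesis
    using ml unfolding alternating_form_def by (auto dest!: not_distinct_decomp)
qed

lemma alternating_form_swap:
  assumes "alternating_form \<omega>"
  shows "\<omega> (xs @ x # y # ys) = - \<omega> (xs @ y # x # ys)"
proof -
  have ml: "multilinear_form \<omega>" using assms by (rule alternating_form_multilinear)
  have "\<omega> (xs @ (x + y) # (x + y) # ys) = 0" by (rule alternating_form_adjacent[OF assms])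
  then have "\<omega> (xs @ x # y # ys) + \<omega> (xs @ y # x # ys) = 0"
    using multilinear_form_add[OF ml, of xs x y "(x + y) # ys"]
      multilinear_form_add[OF ml, of "xs @ [x]" x y ys]
      multilinear_form_add[OF ml, of "xs @ [y]" x y ys]
    by (simp add: alternating_form_adjacent[OF assms])
  then show ?thesis by (simp add: eq_neg_iff_add_eq_0)
qed

lemma multilinear_form_interior: "multilinear_form \<omega> \<Longrightarrow> multilinear_form (interior_product x \<omega>)"
  unfolding multilinear_form_def interior_product_def by (simp flip: append_Cons)

lemma multilinear_form_involution: "multilinear_form \<omega> \<Longrightarrow> multilinear_form (involution \<omega>)"
  by (rule multilinear_formI)
    (simp_all add: involution_def multilinear_form_add multilinear_form_scale algebra_simps)

lemma alternating_form_interior: "alternating_form \<omega> \<Longrightarrow> alternating_form (interior_product x \<omega>)"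
  unfolding alternating_form_def by (simp add: multilinear_form_interior, simp add: interior_product_def)

lemma alternating_form_involution: "alternating_form \<omega> \<Longrightarrow> alternating_form (involution \<omega>)"
  unfolding alternating_form_def by (simp add: multilinear_form_involution, simp add: involution_def)

lemma interior_add_vector:
  "multilinear_form \<omega> \<Longrightarrow> interior_product (x + y) \<omega> = (\<lambda>xs. interior_product x \<omega> xs + interior_product y \<omega> xs)"
  using multilinear_form_add[of \<omega> "[]"] by (auto simp: interior_product_def)

lemma interior_scale_vector:
  "multilinear_form \<omega> \<Longrightarrow> interior_product (c *\<^sub>C x) \<omega> = (\<lambda>xs. c * interior_product x \<omega> xs)"
  using multilinear_form_scale[of \<omega> "[]"] by (auto simp: interior_product_def)

lemma interior_interior_self: "alternating_form \<omega> \<Longrightarrow> interior_product x (interior_product x \<omega>) = (\<lambda>_. 0)"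
  by (auto simp: interior_product_def alternating_form_def)

lemma interior_lincomb:
  "interior_product x (\<lambda>xs. \<alpha> xs + \<beta> xs) = (\<lambda>xs. interior_product x \<alpha> xs + interior_product x \<beta> xs)"
  "interior_product x (\<lambda>xs. \<alpha> xs - \<beta> xs) = (\<lambda>xs. interior_product x \<alpha> xs - interior_product x \<beta> xs)"
  "interior_product x (\<lambda>xs. - \<alpha> xs) = (\<lambda>xs. - interior_product x \<alpha> xs)"
  "interior_product x (\<lambda>xs. c * \<alpha> xs) = (\<lambda>xs. c * interior_product x \<alpha> xs)"
  "interior_product x (\<lambda>xs. 0) = (\<lambda>xs. 0)"
  by (simp_all add: interior_product_def fun_eq_iff)

lemma involution_lincomb:
  "involution (\<lambda>xs. \<alpha> xs + \<beta> xs) = (\<lambda>xs. involution \<alpha> xs + involution \<beta> xs)"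
  "involution (\<lambda>xs. \<alpha> xs - \<beta> xs) = (\<lambda>xs. involution \<alpha> xs - involution \<beta> xs)"
  "involution (\<lambda>xs. - \<alpha> xs) = (\<lambda>xs. - involution \<alpha> xs)"
  "involution (\<lambda>xs. c * \<alpha> xs) = (\<lambda>xs. c * involution \<alpha> xs)"
  "involution (\<lambda>xs. 0) = (\<lambda>xs. 0)"
  by (simp_all add: involution_def fun_eq_iff algebra_simps)

lemma interior_involution: "interior_product x (involution \<omega>) = (\<lambda>xs. - involution (interior_product x \<omega>) xs)"
  by (simp add: interior_product_def involution_def fun_eq_iff)

lemma involution_involution: "involution (involution \<omega>) = \<omega>"
  by (simp add: involution_def fun_eq_iff flip: mult.assoc)

subsection \<open>The exterior product\<close>

lemma wedge_add_left: "wedge (\<lambda>xs. \<alpha> xs + \<alpha>' xs) \<beta> xs = wedge \<alpha> \<beta> xs + wedge \<alpha>' \<beta> xs"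
  by (induction xs arbitrary: \<alpha> \<alpha>' \<beta>) (simp_all add: interior_lincomb involution_lincomb algebra_simps)

lemma wedge_add_right: "wedge \<alpha> (\<lambda>xs. \<beta> xs + \<beta>' xs) xs = wedge \<alpha> \<beta> xs + wedge \<alpha> \<beta>' xs"
  by (induction xs arbitrary: \<alpha> \<beta> \<beta>') (simp_all add: interior_lincomb algebra_simps)

lemma wedge_scale_left: "wedge (\<lambda>xs. c * \<alpha> xs) \<beta> xs = c * wedge \<alpha> \<beta> xs"
  by (induction xs arbitrary: \<alpha> \<beta>) (simp_all add: interior_lincomb involution_lincomb algebra_simps)

lemma wedge_scale_right: "wedge \<alpha> (\<lambda>xs. c * \<beta> xs) xs = c * wedge \<alpha> \<beta> xs"
  by (induction xs arbitrary: \<alpha> \<beta>) (simp_all add: interior_lincomb algebra_simps)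

lemma wedge_zero: "wedge (\<lambda>_. 0) \<beta> xs = 0" "wedge \<alpha> (\<lambda>_. 0) xs = 0"
  using wedge_scale_left[of 0 "\<lambda>_. 0"] wedge_scale_right[of \<alpha> 0 "\<lambda>_. 0"] by simp_all

lemma wedge_uminus: "wedge (\<lambda>xs. - \<alpha> xs) \<beta> xs = - wedge \<alpha> \<beta> xs"
    "wedge \<alpha> (\<lambda>xs. - \<beta> xs) xs = - wedge \<alpha> \<beta> xs"
  using wedge_scale_left[of "- 1" \<alpha>] wedge_scale_right[of \<alpha> "- 1" \<beta>] by simp_all

lemma wedge_diff: "wedge (\<lambda>xs. \<alpha> xs - \<alpha>' xs) \<beta> xs = wedge \<alpha> \<beta> xs - wedge \<alpha>' \<beta> xs"
    "wedge \<alpha> (\<lambda>xs. \<beta> xs - \<beta>' xs) xs = wedge \<alpha> \<beta> xs - wedge \<alpha> \<beta>' xs"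
  using wedge_add_left[of \<alpha> "\<lambda>xs. - \<alpha>' xs"] wedge_add_right[of \<alpha> \<beta> "\<lambda>xs. - \<beta>' xs"]
  by (simp_all add: wedge_uminus)

lemmas wedge_lincomb = wedge_add_left wedge_add_right wedge_scale_left wedge_scale_right
  wedge_zero wedge_uminus wedge_diff

lemma interior_wedge:
  "interior_product x (wedge \<alpha> \<beta>) = (\<lambda>xs. wedge (interior_product x \<alpha>) \<beta> xs + wedge (involution \<alpha>) (interior_product x \<beta>) xs)"
  by (simp add: interior_product_def[of x "wedge \<alpha> \<beta>"] fun_eq_iff)

lemma involution_wedge: "involution (wedge \<alpha> \<beta>) xs = wedge (involution \<alpha>) (involution \<beta>) xs"
proof (induction xs arbitrary: \<alpha> \<beta>)
  case (Cons x xs)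
  have "involution (wedge \<alpha> \<beta>) (x # xs)
      = - involution (wedge (interior_product x \<alpha>) \<beta>) xs - involution (wedge (involution \<alpha>) (interior_product x \<beta>)) xs"
    by (simp add: involution_def[of "wedge _ _"] algebra_simps)
  then show ?case by (simp add: Cons interior_involution wedge_lincomb)
qed (simp add: involution_def)

lemma wedge_assoc: "wedge (wedge \<alpha> \<beta>) \<gamma> xs = wedge \<alpha> (wedge \<beta> \<gamma>) xs"
proof (induction xs arbitrary: \<alpha> \<beta> \<gamma>)
  case (Cons x xs)
  have "involution (wedge \<alpha> \<beta>) = wedge (involution \<alpha>) (involution \<beta>)"
    by (simp add: fun_eq_iff involution_wedge)
  then show ?case by (simp add: Cons interior_wedge wedge_lincomb)
qed simp

lemma multilinear_form_wedge:
  assumes "multilinear_form \<alpha>" "multilinear_form \<beta>"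
  shows "multilinear_form (wedge \<alpha> \<beta>)"
proof (rule multilinear_formI)
  fix xs ys :: "'a list" and x y c
  show "wedge \<alpha> \<beta> (xs @ (x + y) # ys) = wedge \<alpha> \<beta> (xs @ x # ys) + wedge \<alpha> \<beta> (xs @ y # ys)"
    using assms
    by (induction xs arbitrary: \<alpha> \<beta>)
      (simp_all add: interior_add_vector wedge_lincomb multilinear_form_interior
        multilinear_form_involution)
  show "wedge \<alpha> \<beta> (xs @ (c *\<^sub>C x) # ys) = c * wedge \<alpha> \<beta> (xs @ x # ys)"
    using assms
    by (induction xs arbitrary: \<alpha> \<beta>)
      (simp_all add: interior_scale_vector wedge_lincomb multilinear_form_interior
        multilinear_form_involution algebra_simps)
qed

lemma alternating_form_wedge:
  assumes "alternating_form \<alpha>" "alternating_form \<beta>"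
  shows "alternating_form (wedge \<alpha> \<beta>)"
proof (rule alternating_formI)
  show "multilinear_form (wedge \<alpha> \<beta>)"
    using assms by (simp add: multilinear_form_wedge alternating_form_multilinear)
  fix xs ys :: "'a list" and x
  show "wedge \<alpha> \<beta> (xs @ x # x # ys) = 0"
    using assms
    by (induction xs arbitrary: \<alpha> \<beta>)
      (simp_all add: interior_interior_self interior_involution involution_involution wedge_lincomb
        alternating_form_interior alternating_form_involution)
qed

lemma wedge_bound:
  assumes "\<And>ys. a \<le> length ys \<Longrightarrow> \<alpha> ys = 0" "\<And>ys. b \<le> length ys \<Longrightarrow> \<beta> ys = 0"
    and "a + b \<le> Suc (length xs)"
  shows "wedge \<alpha> \<beta> xs = 0"
  using assms
proof (induction xs arbitrary: \<alpha> \<beta> a b)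
  case Nil
  then show ?case by (cases a; cases b) auto
next
  case (Cons x xs)
  show ?case
  proof (cases "a = 0 \<or> b = 0")
    case True
    then have "\<alpha> = (\<lambda>_. 0) \<or> \<beta> = (\<lambda>_. 0)" using Cons.prems by auto
    then show ?thesis by (metis wedge_zero)
  next
    case False
    have "wedge (interior_product x \<alpha>) \<beta> xs = 0"
      by (rule Cons.IH[of "a - 1" _ b]) (use False Cons.prems in \<open>auto simp: interior_product_def\<close>)
    moreover have "wedge (involution \<alpha>) (interior_product x \<beta>) xs = 0"
      by (rule Cons.IH[of a _ "b - 1"])
        (use False Cons.prems in \<open>auto simp: interior_product_def involution_def\<close>)
    ultimately show ?thesis by simp
  qed
qed

lemma bounded_degree_wedge: "bounded_degree \<alpha> \<Longrightarrow> bounded_degree \<beta> \<Longrightarrow> bounded_degree (wedge \<alpha> \<beta>)"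
  unfolding bounded_degree_def by (metis wedge_bound le_SucI)

definition homogeneous_form :: "nat \<Rightarrow> ('v list \<Rightarrow> complex) \<Rightarrow> bool"
  where "homogeneous_form p \<omega> \<longleftrightarrow> (\<forall>xs. length xs \<noteq> p \<longrightarrow> \<omega> xs = 0)"

lemma homogeneous_form_interior: "homogeneous_form (Suc p) \<omega> \<Longrightarrow> homogeneous_form p (interior_product x \<omega>)"
  by (simp add: homogeneous_form_def interior_product_def)

lemma homogeneous_form_0_interior: "homogeneous_form 0 \<omega> \<Longrightarrow> interior_product x \<omega> = (\<lambda>_. 0)"
  by (simp add: homogeneous_form_def interior_product_def fun_eq_iff)

lemma homogeneous_form_involution:
  "homogeneous_form p \<omega> \<Longrightarrow> involution \<omega> = (\<lambda>xs. (- 1) ^ p * \<omega> xs)"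
  by (auto simp: homogeneous_form_def involution_def fun_eq_iff)

lemma homogeneous_form_wedge:
  assumes "homogeneous_form p \<alpha>" "homogeneous_form q \<beta>"
  shows "homogeneous_form (p + q) (wedge \<alpha> \<beta>)"
  unfolding homogeneous_form_def
proof (intro allI impI)
  fix xs :: "'a list" assume "length xs \<noteq> p + q"
  then show "wedge \<alpha> \<beta> xs = 0"
    using assms
  proof (induction xs arbitrary: \<alpha> \<beta> p q)
    case Nil
    then show ?case by (auto simp: homogeneous_form_def)
  next
    case (Cons x xs)
    have "wedge (interior_product x \<alpha>) \<beta> xs = 0"
      using Cons
      by (cases p) (auto simp: homogeneous_form_0_interior wedge_zero homogeneous_form_interior)
    moreover have "wedge \<alpha> (interior_product x \<beta>) xs = 0"
      using Cons
      by (cases q) (auto simp: homogeneous_form_0_interior wedge_zero homogeneous_form_interior)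
    ultimately show ?case
      using Cons.prems by (simp add: homogeneous_form_involution wedge_lincomb)
  qed
qed

lemma wedge_commute:
  assumes "homogeneous_form p \<alpha>" "homogeneous_form q \<beta>"
  shows "wedge \<alpha> \<beta> xs = (- 1) ^ (p * q) * wedge \<beta> \<alpha> xs"
  using assms
proof (induction xs arbitrary: \<alpha> \<beta> p q)
  case Nil
  then show ?case by (cases p; cases q) (auto simp: homogeneous_form_def)
next
  case (Cons x xs)
  have 1: "wedge (interior_product x \<alpha>) \<beta> xs = (- 1) ^ (p * q) * ((- 1) ^ q * wedge \<beta> (interior_product x \<alpha>) xs)"
  proof (cases p)
    case 0
    then show ?thesis using Cons.prems by (simp add: homogeneous_form_0_interior wedge_zero)
  next
    case (Suc p')
    from Cons.IH[of p' "interior_product x \<alpha>" q \<beta>] Cons.prems Suc show ?thesis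
      by (cases "even q") (simp_all add: homogeneous_form_interior power_add)
  qed
  have 2: "wedge \<alpha> (interior_product x \<beta>) xs = (- 1) ^ (p * q) * ((- 1) ^ p * wedge (interior_product x \<beta>) \<alpha> xs)"
  proof (cases q)
    case 0
    then show ?thesis using Cons.prems by (simp add: homogeneous_form_0_interior wedge_zero)
  next
    case (Suc q')
    from Cons.IH[of p \<alpha> q' "interior_product x \<beta>"] Cons.prems Suc show ?thesis
      by (cases "even p") (simp_all add: homogeneous_form_interior power_add)
  qed
  have "(- 1) ^ p * (a * ((- 1) ^ p * b)) = a * b" for a b :: complex
    by (cases "even p") auto
  then show ?case
    using Cons.prems
    by (simp add: homogeneous_form_involution wedge_lincomb 1 2 distrib_left)
qed

lemma wedge_one_left: "wedge (\<lambda>xs. if xs = [] then 1 else 0) \<beta> xs = \<beta> xs"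
proof (induction xs arbitrary: \<beta>)
  case (Cons x xs)
  have "interior_product x (\<lambda>xs. if xs = [] then 1 else 0) = (\<lambda>_. 0)"
    "involution (\<lambda>xs :: 'a list. if xs = [] then 1 else 0) = (\<lambda>xs. if xs = [] then 1 else 0)"
    by (auto simp: interior_product_def involution_def)
  then show ?case by (simp add: Cons wedge_zero) (simp add: interior_product_def)
qed simp

lemma wedge_one_right: "wedge \<alpha> (\<lambda>xs. if xs = [] then 1 else 0) xs = \<alpha> xs"
proof (induction xs arbitrary: \<alpha>)
  case (Cons x xs)
  have "interior_product x (\<lambda>xs. if xs = [] then 1 else 0) = (\<lambda>_. 0)"
    by (auto simp: interior_product_def)
  then show ?case by (simp add: Cons wedge_zero) (simp add: interior_product_def)
qed simp

subsection \<open>The differential\<close>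

lemma lie_derivative_Nil [simp]: "lie_derivative x \<omega> [] = 0"
  by (simp add: lie_derivative_def)

lemma lie_derivative_Cons [simp]:
  "lie_derivative x \<omega> (y # ys) = lie_derivative x (interior_product y \<omega>) ys - interior_product (lie_bracket x y) \<omega> ys"
  by (simp add: lie_derivative_def interior_product_def sum.lessThan_Suc_shift del: sum.lessThan_Suc)

lemma interior_lie_derivative:
  "interior_product y (lie_derivative x \<omega>)
    = (\<lambda>ys. lie_derivative x (interior_product y \<omega>) ys - interior_product (lie_bracket x y) \<omega> ys)"
  by (simp add: interior_product_def[of y "lie_derivative x \<omega>"] fun_eq_iff)

lemma lie_derivative_lincomb:
  "lie_derivative x (\<lambda>xs. \<alpha> xs + \<beta> xs) xs = lie_derivative x \<alpha> xs + lie_derivative x \<beta> xs"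
  "lie_derivative x (\<lambda>xs. \<alpha> xs - \<beta> xs) xs = lie_derivative x \<alpha> xs - lie_derivative x \<beta> xs"
  "lie_derivative x (\<lambda>xs. - \<alpha> xs) xs = - lie_derivative x \<alpha> xs"
  "lie_derivative x (\<lambda>xs. c * \<alpha> xs) xs = c * lie_derivative x \<alpha> xs"
  "lie_derivative x (\<lambda>_. 0) xs = 0"
  by (simp_all add: lie_derivative_def sum.distrib sum_subtractf sum_negf sum_distrib_left)

lemma lie_derivative_involution:
  "lie_derivative x (involution \<omega>) = involution (lie_derivative x \<omega>)"
  by (simp add: lie_derivative_def involution_def fun_eq_iff sum_distrib_left)

lemma lie_derivative_wedge:
  "lie_derivative x (wedge \<alpha> \<beta>) xs
    = wedge (lie_derivative x \<alpha>) \<beta> xs + wedge \<alpha> (lie_derivative x \<beta>) xs"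
  by (induction xs arbitrary: \<alpha> \<beta>)
    (simp_all add: interior_wedge lie_derivative_lincomb interior_lie_derivative wedge_lincomb
      flip: lie_derivative_involution)

lemma ce_differential_lincomb:
  "ce_differential (\<lambda>xs. \<alpha> xs + \<beta> xs) xs = ce_differential \<alpha> xs + ce_differential \<beta> xs"
  "ce_differential (\<lambda>xs. \<alpha> xs - \<beta> xs) xs = ce_differential \<alpha> xs - ce_differential \<beta> xs"
  "ce_differential (\<lambda>xs. - \<alpha> xs) xs = - ce_differential \<alpha> xs"
  "ce_differential (\<lambda>xs. c * \<alpha> xs) xs = c * ce_differential \<alpha> xs"
  "ce_differential (\<lambda>_. 0) xs = 0"
  by (induction xs arbitrary: \<alpha> \<beta>)
    (simp_all add: lie_derivative_lincomb interior_lincomb algebra_simps)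

lemma interior_ce_differential:
  "interior_product x (ce_differential \<omega>) = (\<lambda>xs. lie_derivative x \<omega> xs - ce_differential (interior_product x \<omega>) xs)"
  by (simp add: interior_product_def[of x "ce_differential \<omega>"] fun_eq_iff)

lemma ce_differential_involution:
  "ce_differential (involution \<omega>) = (\<lambda>xs. - involution (ce_differential \<omega>) xs)"
proof
  fix xs show "ce_differential (involution \<omega>) xs = - involution (ce_differential \<omega>) xs"
  proof (induction xs arbitrary: \<omega>)
    case (Cons x xs)
    have "involution (ce_differential \<omega>) (x # xs)
        = - involution (lie_derivative x \<omega>) xs + involution (ce_differential (interior_product x \<omega>)) xs"
      by (simp add: involution_def algebra_simps)
    with Cons show ?case
      by (simp add: lie_derivative_involution interior_involution ce_differential_lincomb)
  qed (simp add: involution_def)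
qed

lemma ce_differential_wedge:
  "ce_differential (wedge \<alpha> \<beta>) xs
    = wedge (ce_differential \<alpha>) \<beta> xs + wedge (involution \<alpha>) (ce_differential \<beta>) xs"
  by (induction xs arbitrary: \<alpha> \<beta>)
    (simp_all add: interior_wedge lie_derivative_wedge ce_differential_lincomb
      interior_ce_differential wedge_lincomb interior_involution involution_involution
      ce_differential_involution)

lemma multilinear_form_lie_derivative:
  assumes "multilinear_form \<omega>"
  shows "multilinear_form (lie_derivative z \<omega>)"
proof (rule multilinear_formI)
  fix xs ys :: "'a list" and x y c
  show "lie_derivative z \<omega> (xs @ (x + y) # ys)
      = lie_derivative z \<omega> (xs @ x # ys) + lie_derivative z \<omega> (xs @ y # ys)"
    using assms
  proof (induction xs arbitrary: \<omega>)
    case (Cons w xs)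
    then show ?case
      using multilinear_form_add[of \<omega> "lie_bracket z w # xs"]
      by (simp add: multilinear_form_interior) (simp add: interior_product_def)
  qed (simp add: interior_add_vector lie_bracket_add_right lie_derivative_lincomb)
  show "lie_derivative z \<omega> (xs @ (c *\<^sub>C x) # ys) = c * lie_derivative z \<omega> (xs @ x # ys)"
    using assms
  proof (induction xs arbitrary: \<omega>)
    case (Cons w xs)
    then show ?case
      using multilinear_form_scale[of \<omega> "lie_bracket z w # xs"]
      by (simp add: multilinear_form_interior algebra_simps) (simp add: interior_product_def algebra_simps)
  qed (simp add: interior_scale_vector lie_bracket_scale_right lie_derivative_lincomb algebra_simps)
qed

lemma alternating_form_lie_derivative:
  assumes "alternating_form \<omega>"
  shows "alternating_form (lie_derivative z \<omega>)"
proof (rule alternating_formI)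
  show "multilinear_form (lie_derivative z \<omega>)"
    using assms by (simp add: multilinear_form_lie_derivative alternating_form_multilinear)
  fix xs ys :: "'a list" and x
  show "lie_derivative z \<omega> (xs @ x # x # ys) = 0"
    using assms
  proof (induction xs arbitrary: \<omega>)
    case Nil
    then show ?case
      using alternating_form_swap[of \<omega> "[]" x "lie_bracket z x" ys]
      by (simp add: interior_interior_self lie_derivative_lincomb) (simp add: interior_product_def)
  next
    case (Cons w xs)
    then show ?case
      using alternating_form_adjacent[of \<omega> "lie_bracket z w # xs"]
      by (simp add: alternating_form_interior) (simp add: interior_product_def)
  qed
qed

lemma lie_derivative_add_vector:
  assumes "multilinear_form \<omega>"
  shows "lie_derivative (x + y) \<omega> xs = lie_derivative x \<omega> xs + lie_derivative y \<omega> xs"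
  using assms
  by (induction xs arbitrary: \<omega>)
    (simp_all add: lie_bracket_add_left interior_add_vector multilinear_form_interior)

lemma lie_derivative_scale_vector:
  assumes "multilinear_form \<omega>"
  shows "lie_derivative (c *\<^sub>C x) \<omega> xs = c * lie_derivative x \<omega> xs"
  using assms
  by (induction xs arbitrary: \<omega>)
    (simp_all add: lie_bracket_scale_left interior_scale_vector multilinear_form_interior algebra_simps)

lemma multilinear_form_ce_differential:
  assumes "multilinear_form \<omega>"
  shows "multilinear_form (ce_differential \<omega>)"
proof (rule multilinear_formI)
  fix xs ys :: "'a list" and x y c
  show "ce_differential \<omega> (xs @ (x + y) # ys)
      = ce_differential \<omega> (xs @ x # ys) + ce_differential \<omega> (xs @ y # ys)"
    using assms
    by (induction xs arbitrary: \<omega>)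
      (simp_all add: interior_add_vector lie_derivative_add_vector ce_differential_lincomb
        multilinear_form_add[OF multilinear_form_lie_derivative] multilinear_form_interior)
  show "ce_differential \<omega> (xs @ (c *\<^sub>C x) # ys) = c * ce_differential \<omega> (xs @ x # ys)"
    using assms
    by (induction xs arbitrary: \<omega>)
      (simp_all add: interior_scale_vector lie_derivative_scale_vector ce_differential_lincomb
        multilinear_form_scale[OF multilinear_form_lie_derivative] multilinear_form_interior
        algebra_simps)
qed

lemma alternating_form_ce_differential:
  assumes "alternating_form \<omega>"
  shows "alternating_form (ce_differential \<omega>)"
proof (rule alternating_formI)
  show "multilinear_form (ce_differential \<omega>)"
    using assms by (simp add: multilinear_form_ce_differential alternating_form_multilinear)
  fix xs ys :: "'a list" and x
  show "ce_differential \<omega> (xs @ x # x # ys) = 0"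
    using assms
  proof (induction xs arbitrary: \<omega>)
    case Nil
    then show ?case
      using multilinear_form_zero[of \<omega> "[]" ys]
      by (simp add: interior_interior_self ce_differential_lincomb lie_bracket_self
          alternating_form_multilinear) (simp add: interior_product_def)
  next
    case (Cons w xs)
    then show ?case
      by (simp add: alternating_form_interior
          alternating_form_adjacent[OF alternating_form_lie_derivative])
  qed
qed

lemma lie_derivative_commutator:
  assumes "multilinear_form \<omega>"
  shows "lie_derivative x (lie_derivative y \<omega>) xs - lie_derivative y (lie_derivative x \<omega>) xs
    = lie_derivative (lie_bracket x y) \<omega> xs"
  using assms
proof (induction xs arbitrary: \<omega>)
  case (Cons z zs)
  have "lie_bracket y (lie_bracket z x) = - lie_bracket y (lie_bracket x z)"
    using lie_bracket_swap[of z x] lie_bracket_scale_right[of y "- 1" "lie_bracket x z"] by simp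
  then have "lie_bracket x (lie_bracket y z)
      = lie_bracket (lie_bracket x y) z + lie_bracket y (lie_bracket x z)"
    using lie_jacobi[of x y z] lie_bracket_swap[of z "lie_bracket x y"]
    by (simp add: algebra_simps)
  then have "interior_product (lie_bracket x (lie_bracket y z)) \<omega> zs
      = interior_product (lie_bracket (lie_bracket x y) z) \<omega> zs
        + interior_product (lie_bracket y (lie_bracket x z)) \<omega> zs"
    by (simp add: interior_add_vector Cons.prems)
  with Cons.IH[of "interior_product z \<omega>"] Cons.prems show ?case
    by (simp add: multilinear_form_interior interior_lie_derivative lie_derivative_lincomb algebra_simps)
qed simp

lemma ce_differential_lie_derivative:
  assumes "multilinear_form \<omega>"
  shows "ce_differential (lie_derivative x \<omega>) xs = lie_derivative x (ce_differential \<omega>) xs"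
  using assms
proof (induction xs arbitrary: \<omega>)
  case (Cons y ys)
  with Cons.IH[of "interior_product y \<omega>"] lie_derivative_commutator[OF Cons.prems, of x y ys] show ?case
    by (simp add: interior_lie_derivative interior_ce_differential lie_derivative_lincomb
        ce_differential_lincomb multilinear_form_interior algebra_simps)
qed simp

lemma ce_differential_ce_differential:
  assumes "multilinear_form \<omega>"
  shows "ce_differential (ce_differential \<omega>) xs = 0"
  using assms
  by (induction xs arbitrary: \<omega>)
    (simp_all add: interior_ce_differential ce_differential_lincomb ce_differential_lie_derivative
      multilinear_form_interior)

lemma homogeneous_form_lie_derivative:
  "homogeneous_form p \<omega> \<Longrightarrow> homogeneous_form p (lie_derivative x \<omega>)"
  by (simp add: homogeneous_form_def lie_derivative_def)

lemma homogeneous_form_ce_differential: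
  assumes "homogeneous_form p \<omega>"
  shows "homogeneous_form (Suc p) (ce_differential \<omega>)"
  unfolding homogeneous_form_def
proof (intro allI impI)
  fix xs :: "'a list" assume "length xs \<noteq> Suc p"
  then show "ce_differential \<omega> xs = 0"
    using assms
  proof (induction xs arbitrary: \<omega> p)
    case (Cons x xs)
    have "lie_derivative x \<omega> xs = 0"
      using homogeneous_form_lie_derivative[OF Cons.prems(2)] Cons.prems(1)
      by (simp add: homogeneous_form_def)
    moreover have "ce_differential (interior_product x \<omega>) xs = 0"
      using Cons
      by (cases p) (auto simp: homogeneous_form_0_interior ce_differential_lincomb
          homogeneous_form_interior)
    ultimately show ?case by simp
  qed simp
qed

lemma bounded_degree_ce_differential:
  assumes "bounded_degree \<omega>"
  shows "bounded_degree (ce_differential \<omega>)"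
proof -
  from assms obtain m where m: "\<And>xs. m \<le> length xs \<Longrightarrow> \<omega> xs = 0"
    unfolding bounded_degree_def by blast
  have "ce_differential \<omega> xs = 0" if "m < length xs" for xs
    using that m
  proof (induction xs arbitrary: \<omega> m)
    case (Cons x xs)
    have "ce_differential (interior_product x \<omega>) xs = 0"
    proof (cases m)
      case 0
      then have "interior_product x \<omega> = (\<lambda>_. 0)" using Cons.prems by (simp add: interior_product_def fun_eq_iff)
      then show ?thesis by (simp add: ce_differential_lincomb)
    next
      case (Suc m')
      show ?thesis by (rule Cons.IH[of m']) (use Cons.prems Suc in \<open>auto simp: interior_product_def\<close>)
    qed
    moreover have "lie_derivative x \<omega> xs = 0"
      using Cons.prems by (simp add: lie_derivative_def)
    ultimately show ?case by simp
  qed simp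
  then show ?thesis unfolding bounded_degree_def by (metis Suc_le_eq)
qed

subsection \<open>The algebra of cochains\<close>

typedef (overloaded) 'n cochain =
  "{\<omega> :: 'n::complex_vector list \<Rightarrow> complex. alternating_form \<omega> \<and> bounded_degree \<omega>}"
  morphisms cochain_eval Abs_cochain
  by (rule exI[of _ "\<lambda>_. 0"])
    (auto simp: alternating_form_def bounded_degree_def intro!: multilinear_formI)

setup_lifting type_definition_cochain

lemma alternating_form_lincomb:
  "alternating_form (\<lambda>_. 0)"
  "alternating_form \<alpha> \<Longrightarrow> alternating_form \<beta> \<Longrightarrow> alternating_form (\<lambda>xs. \<alpha> xs + \<beta> xs)"
  "alternating_form \<alpha> \<Longrightarrow> alternating_form \<beta> \<Longrightarrow> alternating_form (\<lambda>xs. \<alpha> xs - \<beta> xs)"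
  "alternating_form \<alpha> \<Longrightarrow> alternating_form (\<lambda>xs. - \<alpha> xs)"
  "alternating_form \<alpha> \<Longrightarrow> alternating_form (\<lambda>xs. c * \<alpha> xs)"
  by (auto simp: alternating_form_def multilinear_form_add multilinear_form_scale algebra_simps
      intro!: multilinear_formI)

lemma bounded_degree_lincomb:
  "bounded_degree (\<lambda>_. 0)"
  "bounded_degree \<alpha> \<Longrightarrow> bounded_degree (\<lambda>xs. - \<alpha> xs)"
  "bounded_degree \<alpha> \<Longrightarrow> bounded_degree (\<lambda>xs. c * \<alpha> xs)"
  by (auto simp: bounded_degree_def)

lemma bounded_degree_add:
  assumes "bounded_degree \<alpha>" "bounded_degree \<beta>"
  shows "bounded_degree (\<lambda>xs. \<alpha> xs + \<beta> xs)"
proof -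
  from assms obtain m n where "\<And>xs. m \<le> length xs \<Longrightarrow> \<alpha> xs = 0" "\<And>xs. n \<le> length xs \<Longrightarrow> \<beta> xs = 0"
    unfolding bounded_degree_def by blast
  then show ?thesis
    unfolding bounded_degree_def by (intro exI[of _ "max m n"]) simp
qed

lemma bounded_degree_diff:
  "bounded_degree \<alpha> \<Longrightarrow> bounded_degree \<beta> \<Longrightarrow> bounded_degree (\<lambda>xs. \<alpha> xs - \<beta> xs)"
  using bounded_degree_add[of \<alpha> "\<lambda>xs. - \<beta> xs"] by (simp add: bounded_degree_lincomb)

instantiation cochain :: (complex_vector) complex_vector
begin
lift_definition zero_cochain :: "'a cochain" is "\<lambda>_. 0"
  by (simp add: alternating_form_lincomb bounded_degree_lincomb)
lift_definition plus_cochain :: "'a cochain \<Rightarrow> 'a cochain \<Rightarrow> 'a cochain" is "\<lambda>\<alpha> \<beta> xs. \<alpha> xs + \<beta> xs"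
  by (simp add: alternating_form_lincomb bounded_degree_add)
lift_definition minus_cochain :: "'a cochain \<Rightarrow> 'a cochain \<Rightarrow> 'a cochain" is "\<lambda>\<alpha> \<beta> xs. \<alpha> xs - \<beta> xs"
  by (simp add: alternating_form_lincomb bounded_degree_diff)
lift_definition uminus_cochain :: "'a cochain \<Rightarrow> 'a cochain" is "\<lambda>\<alpha> xs. - \<alpha> xs"
  by (simp add: alternating_form_lincomb bounded_degree_lincomb)
lift_definition scaleC_cochain :: "complex \<Rightarrow> 'a cochain \<Rightarrow> 'a cochain" is "\<lambda>c \<alpha> xs. c * \<alpha> xs"
  by (simp add: alternating_form_lincomb bounded_degree_lincomb)
instance
  by standard (transfer; simp add: fun_eq_iff algebra_simps)+
end

instantiation cochain :: (complex_vector) ring_1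
begin
lift_definition one_cochain :: "'a cochain" is "\<lambda>xs. if xs = [] then 1 else 0"
  by (auto simp: alternating_form_def bounded_degree_def intro!: multilinear_formI exI[of _ 1])
lift_definition times_cochain :: "'a cochain \<Rightarrow> 'a cochain \<Rightarrow> 'a cochain" is wedge
  by (simp add: alternating_form_wedge bounded_degree_wedge)
instance
proof
  show "(0 :: 'a cochain) \<noteq> 1"
    by transfer (metis zero_neq_one)
qed (transfer; simp add: fun_eq_iff wedge_assoc wedge_lincomb wedge_one_left wedge_one_right)+
end

lemma minus_one_power_mult:
  "(- 1) ^ n * a = (- 1) ^ n *\<^sub>C (a :: 'a::complex_vector cochain)"
  by (cases "even n") simp_all

lift_definition cochain_component :: "nat \<Rightarrow> 'n::complex_vector cochain \<Rightarrow> 'n cochain"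
  is "\<lambda>k \<omega> xs. if length xs = k then \<omega> xs else 0"
  by (auto simp: alternating_form_def bounded_degree_def multilinear_form_add
      multilinear_form_scale intro!: multilinear_formI)

lemma cochain_eval_sum: "cochain_eval (\<Sum>i\<in>I. f i) xs = (\<Sum>i\<in>I. cochain_eval (f i) xs)"
  by (induction I rule: infinite_finite_induct)
    (simp_all add: zero_cochain.rep_eq plus_cochain.rep_eq)

instantiation cochain :: (complex_lie_algebra) connected_cdga
begin

definition degree_part_cochain :: "nat \<Rightarrow> 'a cochain set"
  where "degree_part_cochain p = {\<omega>. \<forall>xs. length xs \<noteq> p \<longrightarrow> cochain_eval \<omega> xs = 0}"

lift_definition differential_cochain :: "'a cochain \<Rightarrow> 'a cochain" is ce_differential
  by (simp add: alternating_form_ce_differential bounded_degree_ce_differential)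

instance
proof
  fix a b :: "'a cochain" and c :: complex and p q i n :: nat and f :: "nat \<Rightarrow> 'a cochain"
  have dp: "a \<in> degree_part p \<longleftrightarrow> homogeneous_form p (cochain_eval a)" for a :: "'a cochain" and p
    by (simp add: degree_part_cochain_def homogeneous_form_def)
  show "(c *\<^sub>C a) * b = c *\<^sub>C (a * b)" "a * (c *\<^sub>C b) = c *\<^sub>C (a * b)"
    by (transfer; simp add: fun_eq_iff wedge_lincomb)+
  show "0 \<in> (degree_part p :: 'a cochain set)"
    by (simp add: degree_part_cochain_def zero_cochain.rep_eq)
  show "a \<in> degree_part p \<Longrightarrow> b \<in> degree_part p \<Longrightarrow> a + b \<in> degree_part p"
    by (simp add: degree_part_cochain_def plus_cochain.rep_eq)
  show "a \<in> degree_part p \<Longrightarrow> c *\<^sub>C a \<in> degree_part p"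
    by (simp add: degree_part_cochain_def scaleC_cochain.rep_eq)
  show "\<exists>n f. (\<forall>i. f i \<in> degree_part i) \<and> a = (\<Sum>i\<le>n. f i)"
  proof -
    obtain m where m: "\<And>xs. m \<le> length xs \<Longrightarrow> cochain_eval a xs = 0"
      using cochain_eval[of a] by (auto simp: bounded_degree_def)
    have "a = (\<Sum>i\<le>m. cochain_component i a)"
      by (rule cochain_eval_inject[THEN iffD1])
        (use m in \<open>auto simp: fun_eq_iff cochain_eval_sum cochain_component.rep_eq\<close>)
    moreover have "cochain_component i a \<in> degree_part i" for i
      by (simp add: degree_part_cochain_def cochain_component.rep_eq)
    ultimately show ?thesis
      by (intro exI[of _ m] exI[of _ "\<lambda>i. cochain_component i a"]) auto
  qed
  show "f i = 0" if f: "\<And>i. f i \<in> degree_part i" and sum: "(\<Sum>i\<le>n. f i) = 0" and "i \<le> n"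
  proof -
    have "cochain_eval (f i) xs = 0" for xs
    proof (cases "length xs = i")
      case True
      have "cochain_eval (f j) xs = 0" if "j \<noteq> i" for j
        using f[of j] that True by (auto simp: degree_part_cochain_def)
      then have "cochain_eval (\<Sum>i\<le>n. f i) xs = cochain_eval (f i) xs"
        using \<open>i \<le> n\<close> by (simp add: cochain_eval_sum plus_cochain.rep_eq sum.remove[of _ i])
      then show ?thesis by (simp add: sum zero_cochain.rep_eq)
    next
      case False
      with f[of i] show ?thesis by (auto simp: degree_part_cochain_def)
    qed
    then show ?thesis by transfer auto
  qed
  show "1 \<in> (degree_part 0 :: 'a cochain set)"
    by (simp add: degree_part_cochain_def one_cochain.rep_eq)
  show "a \<in> degree_part p \<Longrightarrow> b \<in> degree_part q \<Longrightarrow> a * b \<in> degree_part (p + q)"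
    by (simp add: dp times_cochain.rep_eq homogeneous_form_wedge)
  show "a \<in> degree_part p \<Longrightarrow> b \<in> degree_part q \<Longrightarrow> a * b = (- 1) ^ (p * q) * (b * a)"
    unfolding dp minus_one_power_mult by transfer (auto intro: wedge_commute)
  show "differential (a + b) = differential a + differential b"
    by transfer (simp add: fun_eq_iff ce_differential_lincomb)
  show "differential (c *\<^sub>C a) = c *\<^sub>C differential a"
    by transfer (simp add: fun_eq_iff ce_differential_lincomb)
  show "a \<in> degree_part p \<Longrightarrow> differential a \<in> degree_part (Suc p)"
    by (simp add: dp differential_cochain.rep_eq homogeneous_form_ce_differential)
  show "a \<in> degree_part p \<Longrightarrow>
      differential (a * b) = differential a * b + (- 1) ^ p * (a * differential b)"
    unfolding dp minus_one_power_mult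
    by transfer (simp add: fun_eq_iff ce_differential_wedge homogeneous_form_involution wedge_lincomb)
  show "differential (differential a) = 0"
    by transfer (simp add: fun_eq_iff ce_differential_ce_differential alternating_form_multilinear)
  show "(degree_part 0 :: 'a cochain set) = {c *\<^sub>C 1 | c. True}"
  proof (intro equalityI subsetI)
    fix a :: "'a cochain" assume "a \<in> degree_part 0"
    then have "a = cochain_eval a [] *\<^sub>C 1"
      by (intro cochain_eval_inject[THEN iffD1])
        (auto simp: degree_part_cochain_def fun_eq_iff scaleC_cochain.rep_eq one_cochain.rep_eq)
    then show "a \<in> {c *\<^sub>C 1 | c. True}" by blast
  qed (auto simp: degree_part_cochain_def scaleC_cochain.rep_eq one_cochain.rep_eq)
qed

end

lemma cochain_eval_mult_degree_1:
  assumes "\<alpha> \<in> degree_part 1" "\<beta> \<in> degree_part 1"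
  shows "cochain_eval (\<alpha> * \<beta>) [x, y]
    = cochain_eval \<alpha> [x] * cochain_eval \<beta> [y] - cochain_eval \<alpha> [y] * cochain_eval \<beta> [x]"
  using assms
  by (simp add: times_cochain.rep_eq degree_part_cochain_def interior_product_def involution_def)

lemma cochain_eval_differential_pair:
  "cochain_eval (differential \<eta>) [x, y] = - cochain_eval \<eta> [lie_bracket x y]"
  by (simp add: differential_cochain.rep_eq interior_product_def)

lemma degree_part_1_dual:
  "bij_betw (\<lambda>\<eta> x. cochain_eval \<eta> [x]) (degree_part 1)
     {f :: 'n::complex_lie_algebra \<Rightarrow> complex. clinear f}"
proof (rule bij_betwI')
  fix \<eta> \<theta> :: "'n cochain" assume *: "\<eta> \<in> degree_part 1" "\<theta> \<in> degree_part 1"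
  show "((\<lambda>x. cochain_eval \<eta> [x]) = (\<lambda>x. cochain_eval \<theta> [x])) = (\<eta> = \<theta>)"
  proof
    assume eq: "(\<lambda>x. cochain_eval \<eta> [x]) = (\<lambda>x. cochain_eval \<theta> [x])"
    have "cochain_eval \<eta> xs = cochain_eval \<theta> xs" for xs
    proof (cases "length xs = 1")
      case True
      then obtain x where "xs = [x]" by (auto simp: length_Suc_conv)
      then show ?thesis using fun_cong[OF eq, of x] by simp
    qed (use * in \<open>auto simp: degree_part_cochain_def\<close>)
    then show "\<eta> = \<theta>" by transfer auto
  qed simp
next
  fix \<eta> :: "'n cochain" assume "\<eta> \<in> degree_part 1"
  have "multilinear_form (cochain_eval \<eta>)"
    using cochain_eval[of \<eta>] by (simp add: alternating_form_def)
  from multilinear_form_add[OF this, of "[]" _ _ "[]"] multilinear_form_scale[OF this, of "[]" _ _ "[]"]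
  show "(\<lambda>x. cochain_eval \<eta> [x]) \<in> {f. clinear f}"
    by (intro CollectI clinearI) (simp_all add: scaleC_complex_def)
next
  fix f :: "'n \<Rightarrow> complex" assume "f \<in> {f. clinear f}"
  then have f: "clinear f" by simp
  define \<omega> where "\<omega> = (\<lambda>xs. case xs of [x] \<Rightarrow> f x | _ \<Rightarrow> 0)"
  have [simp]: "\<omega> (xs @ x # ys) = (if xs = [] \<and> ys = [] then f x else 0)" for xs x ys
    by (auto simp: \<omega>_def split: list.splits) (auto simp: append_eq_Cons_conv)
  have "alternating_form \<omega>"
    by (rule alternating_formI)
      (auto intro!: multilinear_formI simp: clinear_add[OF f] clinear_scale[OF f] scaleC_complex_def)
  moreover have deg: "\<omega> xs = 0" if "length xs \<noteq> 1" for xs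
    using that by (auto simp: \<omega>_def split: list.splits)
  then have "bounded_degree \<omega>"
    by (auto simp: bounded_degree_def intro!: exI[of _ 2])
  ultimately have eval: "cochain_eval (Abs_cochain \<omega>) = \<omega>"
    by (simp add: Abs_cochain_inverse)
  have "Abs_cochain \<omega> \<in> degree_part 1"
    by (simp add: degree_part_cochain_def eval deg)
  moreover have "f = (\<lambda>x. cochain_eval (Abs_cochain \<omega>) [x])"
    unfolding eval by (simp add: \<omega>_def)
  ultimately show "\<exists>\<eta> \<in> degree_part 1. f = (\<lambda>x. cochain_eval \<eta> [x])" by blast
qed

end

theory Submission
  imports Defs
begin

text \<open>
  A tensor \<open>\<omega>\<close> in \<open>A\<^sup>1 \<otimes> \<gg>\<close>, where \<open>A\<close> is the Chevalley--Eilenberg algebra of \<open>\<nn>\<close>, is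
  the same thing as a linear map \<open>\<phi> : \<nn> \<rightarrow> \<gg>\<close>, obtained by evaluating the first tensor factor.
  Evaluating the flatness equation on a pair \<open>x, y\<close> turns it into
  \<open>- \<phi> [x, y] + [\<phi> x, \<phi> y] = 0\<close>, so flat connections are Lie algebra homomorphisms, and the
  tensors \<open>\<eta> \<otimes> g\<close> with \<open>d \<eta> = 0\<close> are the homomorphisms whose image lies in a line.
  The claim is therefore that every homomorphism from a nilpotent Lie algebra to \<open>\<gg>\<close> has rank
  at most one (\<open>flat_connections_eq_if_homomorphisms_rank_one\<close>).

  Both Lie algebras consist of traceless matrices of size two, where this is a consequence of
  \<open>(ad A)\<^sup>3 = - 4 det A \<cdot> ad A\<close>. If \<open>A\<close> and \<open>B\<close> lie in the image and do not commute, then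
  \<open>ad A\<close>, being nilpotent on the image, forces \<open>det A = 0\<close>; the same applies to \<open>B\<close> and
  \<open>A + B\<close>. So \<open>A\<close> and \<open>B\<close> span a totally isotropic subspace for the quadratic form \<open>det\<close>
  on the three-dimensional space of traceless matrices. This form is nondegenerate, hence its
  isotropic subspaces are at most lines and \<open>A\<close> and \<open>B\<close> are proportional, a contradiction.
  Consequently the image is commutative, and commuting traceless matrices of size two are
  proportional.
\<close>

section \<open>Traceless matrices of size two\<close>

lemma traceless_entry: "trace (A :: complex^2^2) = 0 \<Longrightarrow> A $ 2 $ 2 = - A $ 1 $ 1"
  by (simp add: trace_def sum_2 add_eq_0_iff)

lemma commutator_scaleC_right:
  "commutator A (c *\<^sub>C B) = c *\<^sub>C commutator A (B :: complex^2^2)"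
  by (simp add: mat2_simps algebra_simps)

text \<open>
  If the eigenvalues of \<open>A\<close> are \<open>\<lambda>\<close> and \<open>- \<lambda>\<close>, then those of \<open>ad A\<close> are \<open>0\<close>, \<open>2 \<lambda>\<close> and
  \<open>- 2 \<lambda>\<close>, and \<open>\<lambda>\<^sup>2 = - det A\<close>; this is the Cayley--Hamilton identity for \<open>ad A\<close>.
\<close>

lemma commutator_cubed:
  fixes A B :: "complex^2^2"
  assumes "trace A = 0"
  shows "commutator A (commutator A (commutator A B)) = (- 4 * det A) *\<^sub>C commutator A B"
  by (simp add: mat2_simps det_2 traceless_entry[OF assms] algebra_simps)

lemma commutator_odd_power:
  fixes A B :: "complex^2^2"
  assumes "trace A = 0"
  shows "(commutator A ^^ Suc (k + k)) B = (- 4 * det A) ^ k *\<^sub>C commutator A B"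
proof (induction k)
  case 0
  then show ?case by (simp add: complex_vector.scale_one)
next
  case (Suc k)
  have "(commutator A ^^ Suc (Suc k + Suc k)) B
      = commutator A (commutator A ((commutator A ^^ Suc (k + k)) B))"
    by simp
  also have "\<dots> = (- 4 * det A) ^ k *\<^sub>C (- 4 * det A) *\<^sub>C commutator A B"
    by (simp only: Suc commutator_scaleC_right commutator_cubed[OF assms])
  finally show ?case
    by (simp only: complex_vector.scale_scale power_Suc mult.commute)
qed

lemma det_zero_if_ad_nilpotent:
  fixes A B :: "complex^2^2"
  assumes "trace A = 0" "(commutator A ^^ Suc (k + k)) B = 0" "commutator A B \<noteq> 0"
  shows "det A = 0"
  using assms commutator_odd_power[OF assms(1), of k B] by (auto simp del: funpow.simps)

text \<open>
  On traceless matrices \<open>det\<close> is a nondegenerate quadratic form in three variables, whose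
  totally isotropic subspaces have dimension at most one. In coordinates, the entries of the
  commutator are, up to a factor, the two-by-two minors of the pair \<open>A, B\<close>, and each minor has
  square zero.
\<close>

lemma commutator_zero_if_isotropic:
  fixes A B :: "complex^2^2"
  assumes tr: "trace A = 0" "trace B = 0"
    and det: "det A = 0" "det B = 0" "det (A + B) = 0"
  shows "commutator A B = 0"
proof -
  define a b c where "a = A $ 1 $ 1" "b = A $ 1 $ 2" "c = A $ 2 $ 1"
  define a' b' c' where "a' = B $ 1 $ 1" "b' = B $ 1 $ 2" "c' = B $ 2 $ 1"
  note defs = a_b_c_def a'_b'_c'_def
  note entries = traceless_entry[OF tr(1)] traceless_entry[OF tr(2)]
  have A: "a * a + b * c = 0" and B: "a' * a' + b' * c' = 0"
    using det(1,2) by (simp_all add: det_2 entries defs) algebra+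
  \<comment> \<open>The polarisation of \<open>det\<close>: \<open>A\<close> and \<open>B\<close> are orthogonal.\<close>
  have AB: "2 * (a * a') + b * c' + b' * c = 0"
    using det(3) A B by (simp add: det_2 entries defs) algebra
  have "(b * c' - b' * c)\<^sup>2 = 0" "(a * b' - a' * b)\<^sup>2 = 0" "(c * a' - c' * a)\<^sup>2 = 0"
    using A B AB by algebra+
  then show ?thesis
    by (simp add: mat2_simps entries defs algebra_simps)
qed

lemma proportional_if_commute:
  fixes A B :: "complex^2^2"
  assumes tr: "trace A = 0" "trace B = 0" and comm: "commutator A B = 0" and "A \<noteq> 0"
  shows "\<exists>c. B = c *\<^sub>C A"
proof -
  note entries = traceless_entry[OF tr(1)] traceless_entry[OF tr(2)]
  have "commutator A B $ 1 $ 1 = A$1$2 * B$2$1 - B$1$2 * A$2$1"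
      "commutator A B $ 1 $ 2 = 2 * (A$1$1 * B$1$2 - B$1$1 * A$1$2)"
      "commutator A B $ 2 $ 1 = 2 * (A$2$1 * B$1$1 - B$2$1 * A$1$1)"
    by (simp_all add: commutator_def matrix_matrix_mult_def sum_2 entries algebra_simps)
  then have eqs: "A$1$2 * B$2$1 = B$1$2 * A$2$1" "A$1$1 * B$1$2 = B$1$1 * A$1$2"
      "A$2$1 * B$1$1 = B$2$1 * A$1$1"
    by (simp_all add: comm)
  have multiple: "\<exists>c. B = c *\<^sub>C A"
    if "B$1$1 = c * A$1$1" "B$1$2 = c * A$1$2" "B$2$1 = c * A$2$1" for c
    using that
    by (intro exI[of _ c]) (simp add: vec_eq_iff forall_2 scaleC_mat_nth entries)
  have quotient: "q = r / p * s" if "p \<noteq> 0" "p * q = r * s" for p q r s :: complex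
    using that by (simp add: nonzero_eq_divide_eq mult.commute)
  have "A$1$1 \<noteq> 0 \<or> A$1$2 \<noteq> 0 \<or> A$2$1 \<noteq> 0"
    using \<open>A \<noteq> 0\<close> by (auto simp: vec_eq_iff forall_2 entries)
  moreover have "\<exists>c. B = c *\<^sub>C A" if "A$1$1 \<noteq> 0"
    using eqs by (intro multiple[of "B$1$1 / A$1$1"] quotient that) (simp_all only: mult.commute)
  moreover have "\<exists>c. B = c *\<^sub>C A" if "A$1$2 \<noteq> 0"
    using eqs by (intro multiple[of "B$1$2 / A$1$2"] quotient that) (simp_all only: mult.commute)
  moreover have "\<exists>c. B = c *\<^sub>C A" if "A$2$1 \<noteq> 0"
    using eqs by (intro multiple[of "B$2$1 / A$2$1"] quotient that) (simp_all only: mult.commute)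
  ultimately show ?thesis by blast
qed

section \<open>Homomorphisms from nilpotent Lie algebras\<close>

lemma ad_power_in_lower_central_series:
  "(lie_bracket x ^^ k) y \<in> lower_central_series k"
  by (induction k) (auto intro: complex_vector.span_base)

lemma lie_bracket_zero_right: "lie_bracket x 0 = (0 :: 'a::complex_lie_algebra)"
  using lie_bracket_scale_right[of x 0 0] by simp

lemma nilpotent_ad_power:
  assumes "nilpotent_lie_algebra TYPE('n::complex_lie_algebra)"
  shows "\<exists>k. \<forall>m. \<forall>x y :: 'n. (lie_bracket x ^^ (m + k)) y = 0"
proof -
  from assms obtain k where k: "lower_central_series k = {0 :: 'n}"
    by (auto simp: nilpotent_lie_algebra_def)
  have "(lie_bracket x ^^ (m + k)) y = 0" for m and x y :: 'n
    using ad_power_in_lower_central_series[of k x y] k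
    by (induction m) (simp_all add: lie_bracket_zero_right)
  then show ?thesis by blast
qed

text \<open>
  Two elements with noncommuting images \<open>A\<close> and \<open>B\<close> are excluded by applying
  \<open>det_zero_if_ad_nilpotent\<close> to the pairs \<open>(A, B)\<close>, \<open>(B, A)\<close> and \<open>(A + B, B)\<close>: it makes
  \<open>A\<close> and \<open>B\<close> isotropic and orthogonal, so that they commute after all. Commuting images are
  proportional by \<open>proportional_if_commute\<close>.
\<close>

lemma homomorphism_traceless_rank_one:
  fixes \<phi> :: "'n::complex_lie_algebra \<Rightarrow> complex^2^2"
  assumes nil: "nilpotent_lie_algebra TYPE('n)"
    and lin: "clinear \<phi>"
    and hom: "\<And>x y. \<phi> (lie_bracket x y) = commutator (\<phi> x) (\<phi> y)"
    and tr: "\<And>x. trace (\<phi> x) = 0"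
  shows "\<exists>z. \<forall>x. \<exists>c. \<phi> x = c *\<^sub>C \<phi> z"
proof -
  have zero: "\<phi> 0 = 0"
    using clinear_scale[OF lin, of 0 0] by simp
  have pow: "\<phi> ((lie_bracket x ^^ k) y) = (commutator (\<phi> x) ^^ k) (\<phi> y)" for x y k
    by (induction k) (simp_all add: hom)
  \<comment> \<open>The extra \<open>m\<close> lets the exponent be odd, as the reduction of powers of \<open>ad A\<close> requires.\<close>
  obtain k where k: "\<And>m (x :: 'n) y. (lie_bracket x ^^ (m + k)) y = 0"
    using nilpotent_ad_power[OF nil] by blast
  have det: "det (\<phi> x) = 0" if "commutator (\<phi> x) (\<phi> y) \<noteq> 0" for x y
  proof (rule det_zero_if_ad_nilpotent[OF tr _ that])
    show "(commutator (\<phi> x) ^^ Suc (k + k)) (\<phi> y) = 0"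
      using pow[of "Suc k + k" x y] k[of "Suc k" x y] by (simp add: zero)
  qed
  have comm: "commutator (\<phi> x) (\<phi> y) = 0" for x y
  proof (rule ccontr)
    assume xy: "commutator (\<phi> x) (\<phi> y) \<noteq> 0"
    then have yx: "commutator (\<phi> y) (\<phi> x) \<noteq> 0"
      by (simp add: commutator_def)
    have "commutator (\<phi> (x + y)) (\<phi> y) \<noteq> 0"
      using xy by (simp add: clinear_add[OF lin] mat2_simps algebra_simps)
    from det[OF xy] det[OF yx] det[OF this] have "commutator (\<phi> x) (\<phi> y) = 0"
      by (intro commutator_zero_if_isotropic) (simp_all add: tr clinear_add[OF lin])
    with xy show False by simp
  qed
  show ?thesis
  proof (cases "\<exists>z. \<phi> z \<noteq> 0")
    case True
    then obtain z where "\<phi> z \<noteq> 0" by blast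
    then have "\<exists>c. \<phi> x = c *\<^sub>C \<phi> z" for x
      by (rule proportional_if_commute[OF tr tr comm])
    then show ?thesis by blast
  next
    case False
    then have "\<phi> x = 0 *\<^sub>C \<phi> 0" for x by simp
    then show ?thesis by blast
  qed
qed

corollary homomorphism_rank_one_if_traceless_representation:
  fixes \<phi> :: "'n::complex_lie_algebra \<Rightarrow> 'g::complex_lie_algebra" and \<rho> :: "'g \<Rightarrow> complex^2^2"
  assumes nil: "nilpotent_lie_algebra TYPE('n)"
    and rep: "clinear \<rho>" "inj \<rho>" "\<And>x. trace (\<rho> x) = 0"
      "\<And>x y. \<rho> (lie_bracket x y) = commutator (\<rho> x) (\<rho> y)"
    and hom: "clinear \<phi>" "\<And>x y. \<phi> (lie_bracket x y) = lie_bracket (\<phi> x) (\<phi> y)"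
  shows "\<exists>z. \<forall>x. \<exists>c. \<phi> x = c *\<^sub>C \<phi> z"
proof -
  have "\<exists>z. \<forall>x. \<exists>c. (\<rho> \<circ> \<phi>) x = c *\<^sub>C (\<rho> \<circ> \<phi>) z"
    by (rule homomorphism_traceless_rank_one[OF nil])
      (auto intro!: clinearI simp: rep hom clinear_add[OF rep(1)] clinear_scale[OF rep(1)]
        clinear_add[OF hom(1)] clinear_scale[OF hom(1)])
  then show ?thesis
    by (simp add: clinear_scale[OF rep(1), symmetric] inj_eq[OF rep(2)])
qed

section \<open>Flat connections as homomorphisms\<close>

lemma tensor_zero_left: "0 \<otimes> y = 0"
  using tensor_scale_left[of 0 0 y] by simp

lemma tensor_zero_right: "x \<otimes> 0 = 0"
  using tensor_scale_right[of x 0 0] by simp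

text \<open>
  Evaluation of the first tensor factor. On one vector this is the linear map \<open>\<nn> \<rightarrow> \<gg>\<close> attached
  to a tensor of degree one; on two vectors it reads off the components of the flatness equation.
\<close>

definition contract ::
    "'n::complex_lie_algebra list \<Rightarrow> ('n cochain, 'g::complex_lie_algebra) tensor \<Rightarrow> 'g"
  where "contract xs = tensor_lift (\<lambda>\<alpha> g. cochain_eval \<alpha> xs *\<^sub>C g)"

lemma cbilinear_contract_aux: "cbilinear (\<lambda>\<alpha> g. cochain_eval \<alpha> xs *\<^sub>C g)"
  unfolding cbilinear_def
  by (intro conjI allI clinearI)
    (simp_all add: plus_cochain.rep_eq scaleC_cochain.rep_eq complex_vector.scale_left_distrib
      complex_vector.scale_right_distrib complex_vector.scale_left_commute)

lemma contract_tensor: "contract xs (\<alpha> \<otimes> g) = cochain_eval \<alpha> xs *\<^sub>C g"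
  unfolding contract_def by (rule tensor_lift_tensor[OF cbilinear_contract_aux])

lemma clinear_contract: "clinear (contract xs)"
  unfolding contract_def by (rule clinear_tensor_lift[OF cbilinear_contract_aux])

lemmas contract_simps = contract_tensor clinear_add[OF clinear_contract]
  clinear_diff[OF clinear_contract] clinear_scale[OF clinear_contract]

lemma contract_zero: "contract xs 0 = 0"
  using clinear_scale[OF clinear_contract, of xs 0 0] by simp

lemma contract_sum: "contract xs (\<Sum>i\<in>I. f i) = (\<Sum>i\<in>I. contract xs (f i))"
  by (induction I rule: infinite_finite_induct) (simp_all add: contract_simps contract_zero)

abbreviation degree_one_tensors :: "('n::complex_lie_algebra cochain, 'g::complex_lie_algebra) tensor set"
  where "degree_one_tensors \<equiv> complex_vector.span {\<alpha> \<otimes> x | \<alpha> x. \<alpha> \<in> degree_part 1}"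

lemma degree_one_tensors_induct [consumes 1, case_names tensor add]:
  assumes "t \<in> degree_one_tensors"
    and tensor: "\<And>\<alpha> x. \<alpha> \<in> degree_part 1 \<Longrightarrow> P (\<alpha> \<otimes> x)"
    and add: "\<And>s t. P s \<Longrightarrow> P t \<Longrightarrow> P (s + t)"
  shows "P t"
  using assms(1)
proof (induction rule: complex_vector.span_induct_alt)
  case base
  show ?case
    using tensor[OF degree_part_zero, of 0] by (simp add: tensor_zero_left)
next
  case (step c x y)
  then obtain \<alpha> g where x: "x = \<alpha> \<otimes> g" "\<alpha> \<in> degree_part 1" by blast
  show ?case
    unfolding x(1) tensor_scale_left[symmetric]
    by (intro add tensor degree_part_scale x step)
qed

lemma clinear_contract_vector:
  assumes "t \<in> degree_one_tensors"
  shows "clinear (\<lambda>x. contract [x] t)"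
  using assms
proof (induction rule: degree_one_tensors_induct)
  case (tensor \<alpha> g)
  then have "clinear (\<lambda>x. cochain_eval \<alpha> [x])"
    using degree_part_1_dual by (auto simp: bij_betw_def)
  from clinear_add[OF this] clinear_scale[OF this] show ?case
    by (intro clinearI)
      (simp_all add: contract_tensor complex_vector.scale_left_distrib scaleC_complex_def)
next
  case (add s t)
  from add(1)[THEN clinear_add] add(1)[THEN clinear_scale]
    add(2)[THEN clinear_add] add(2)[THEN clinear_scale]
  show ?case
    by (intro clinearI) (simp_all add: contract_simps complex_vector.scale_right_distrib add_ac)
qed

lemma contract_differential:
  "contract [x, y] (tensor_differential t) = - contract [lie_bracket x y] t"
  by (induction t rule: tensor_induct)
    (simp_all add: tensor_differential_tensor contract_simps cochain_eval_differential_pair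
      clinear_add[OF clinear_tensor_differential])

lemma contract_bracket:
  assumes "s \<in> degree_one_tensors" "t \<in> degree_one_tensors"
  shows "contract [x, y] (tensor_bracket s t)
    = lie_bracket (contract [x] s) (contract [y] t) - lie_bracket (contract [y] s) (contract [x] t)"
  using assms(1)
proof (induction rule: degree_one_tensors_induct)
  case (tensor \<alpha> g)
  note \<alpha> = tensor
  from assms(2) show ?case
  proof (induction rule: degree_one_tensors_induct)
    case (tensor \<beta> h)
    then show ?case
      using \<alpha> by (simp add: tensor_bracket_tensor contract_simps cochain_eval_mult_degree_1
          lie_bracket_scale_left lie_bracket_scale_right complex_vector.scale_left_diff_distrib
          mult.commute)
  next
    case (add s t)
    then show ?case
      by (simp add: tensor_bracket_tensor_left clinear_add[OF clinear_tensor_bracket_left]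
          contract_simps lie_bracket_add_right)
  qed
next
  case (add s t)
  then show ?case
    by (simp add: clinear_add[OF clinear_tensor_bracket_first] contract_simps lie_bracket_add_left)
qed

text \<open>
  The two terms of the contracted bracket agree by antisymmetry, which cancels the factor
  \<open>1/2\<close> in the flatness equation.
\<close>

lemma flat_connection_homomorphism:
  assumes "\<omega> \<in> flat_connections TYPE('n::complex_lie_algebra cochain) TYPE('g::complex_lie_algebra)"
  shows "contract [lie_bracket x y] \<omega> = lie_bracket (contract [x] \<omega>) (contract [y] \<omega>)"
proof -
  let ?\<phi> = "\<lambda>x. contract [x] \<omega>"
  from assms have \<omega>: "\<omega> \<in> degree_one_tensors"
    and flat: "tensor_differential \<omega> + (1 / 2) *\<^sub>C tensor_bracket \<omega> \<omega> = 0"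
    by (auto simp: flat_connections_def)
  have "lie_bracket (?\<phi> x) (?\<phi> y) - lie_bracket (?\<phi> y) (?\<phi> x)
      = (1 + 1) *\<^sub>C lie_bracket (?\<phi> x) (?\<phi> y)"
    using lie_bracket_swap[of "?\<phi> y" "?\<phi> x"] by (simp only: complex_vector.scale_left_distrib) simp
  then have "(1 / 2) *\<^sub>C contract [x, y] (tensor_bracket \<omega> \<omega>) = lie_bracket (?\<phi> x) (?\<phi> y)"
    by (simp add: contract_bracket[OF \<omega> \<omega>])
  moreover have "contract [x, y] (tensor_differential \<omega> + (1 / 2) *\<^sub>C tensor_bracket \<omega> \<omega>) = 0"
    by (simp only: flat contract_zero)
  ultimately show ?thesis
    by (simp add: contract_simps contract_differential)
qed

lemma degree_one_tensor_basis:
  fixes t :: "('n::complex_lie_algebra cochain, 'g::complex_lie_algebra) tensor"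
  assumes "t \<in> degree_one_tensors"
    and B: "complex_vector.span B = (UNIV :: 'g set)"
  shows "\<exists>F \<alpha>. finite F \<and> F \<subseteq> B \<and> (\<forall>b\<in>F. \<alpha> b \<in> degree_part 1) \<and> t = (\<Sum>b\<in>F. \<alpha> b \<otimes> b)"
  using assms(1)
proof (induction rule: degree_one_tensors_induct)
  case (tensor \<alpha> x)
  from B have "x \<in> complex_vector.span B" by simp
  then obtain F r where F: "finite F" "F \<subseteq> B" and x: "x = (\<Sum>b\<in>F. r b *\<^sub>C b)"
    unfolding complex_vector.span_explicit by blast
  have "\<alpha> \<otimes> x = (\<Sum>b\<in>F. (r b *\<^sub>C \<alpha>) \<otimes> b)"
    using F(1) unfolding x
  proof (induction F)
    case empty
    show ?case by (simp add: tensor_zero_right)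
  qed (simp add: tensor_add_right tensor_scale_left tensor_scale_right)
  with F tensor show ?case
    by (intro exI[of _ F] exI[of _ "\<lambda>b. r b *\<^sub>C \<alpha>"]) (simp add: degree_part_scale)
next
  case (add s t)
  from add(1) obtain F \<alpha> where F: "finite F" "F \<subseteq> B" "\<forall>b\<in>F. \<alpha> b \<in> degree_part 1"
      "s = (\<Sum>b\<in>F. \<alpha> b \<otimes> b)"
    by blast
  from add(2) obtain G \<beta> where G: "finite G" "G \<subseteq> B" "\<forall>b\<in>G. \<beta> b \<in> degree_part 1"
      "t = (\<Sum>b\<in>G. \<beta> b \<otimes> b)"
    by blast
  define \<alpha>' where "\<alpha>' b = (if b \<in> F then \<alpha> b else 0)" for b
  define \<beta>' where "\<beta>' b = (if b \<in> G then \<beta> b else 0)" for b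
  have "s = (\<Sum>b\<in>F \<union> G. \<alpha>' b \<otimes> b)" "t = (\<Sum>b\<in>F \<union> G. \<beta>' b \<otimes> b)"
    unfolding F(4) G(4) using F(1) G(1)
    by (auto simp: \<alpha>'_def \<beta>'_def tensor_zero_left intro!: sum.mono_neutral_cong_left)
  then have "s + t = (\<Sum>b\<in>F \<union> G. (\<alpha>' b + \<beta>' b) \<otimes> b)"
    by (simp add: tensor_add_left sum.distrib)
  moreover have "\<alpha>' b + \<beta>' b \<in> degree_part 1" for b
    using F(3) G(3) by (auto simp: \<alpha>'_def \<beta>'_def intro!: degree_part_add degree_part_zero)
  ultimately show ?case
    using F(1,2) G(1,2) by (intro exI[of _ "F \<union> G"] exI[of _ "\<lambda>b. \<alpha>' b + \<beta>' b"]) auto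
qed

text \<open>
  When the second factors are taken from a basis of \<open>\<gg>\<close>, contraction with \<open>x\<close> gives the
  coefficients \<open>\<alpha>\<^sub>b(x)\<close> of a vector in that basis, and a form \<open>\<alpha>\<^sub>b\<close> of degree one is
  determined by its values. So a tensor of degree one is determined by its linear map
  \<open>\<nn> \<rightarrow> \<gg>\<close>.
\<close>

lemma degree_one_tensor_zero_if_contract_zero:
  fixes t :: "('n::complex_lie_algebra cochain, 'g::complex_lie_algebra) tensor"
  assumes t: "t \<in> degree_one_tensors" and zero: "\<And>x. contract [x] t = 0"
  shows "t = 0"
proof -
  obtain B :: "'g set" where B: "complex_vector.independent B" "complex_vector.span B = UNIV"
    using complex_vector.basis_exists[of UNIV] by (metis top.extremum_uniqueI)
  obtain F \<alpha> where F: "finite F" "F \<subseteq> B" and \<alpha>: "\<forall>b\<in>F. \<alpha> b \<in> degree_part 1"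
    and sum: "t = (\<Sum>b\<in>F. \<alpha> b \<otimes> b)"
    using degree_one_tensor_basis[OF t B(2)] by blast
  have "\<alpha> b = 0" if "b \<in> F" for b
  proof -
    have "cochain_eval (\<alpha> b) [x] = 0" for x
      using complex_vector.independentD[OF B(1) F, of "\<lambda>b. cochain_eval (\<alpha> b) [x]" b] zero[of x] that
      by (simp add: sum contract_sum contract_tensor)
    then have "(\<lambda>x. cochain_eval (\<alpha> b) [x]) = (\<lambda>x. cochain_eval 0 [x])"
      by (simp add: zero_cochain.rep_eq)
    then show ?thesis
      using degree_part_1_dual \<alpha> that degree_part_zero
      by (auto simp: bij_betw_def dest: inj_onD)
  qed
  then show ?thesis
    unfolding sum by (intro sum.neutral) (simp add: tensor_zero_left)
qed

lemma degree_one_tensor_eq_if_contract_rank_one: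
  fixes t :: "('n::complex_lie_algebra cochain, 'g::complex_lie_algebra) tensor"
  assumes t: "t \<in> degree_one_tensors" and h: "clinear h" "\<And>x. contract [x] t = h x *\<^sub>C g"
  obtains \<eta> where "\<eta> \<in> degree_part 1" "\<And>x. cochain_eval \<eta> [x] = h x" "t = \<eta> \<otimes> g"
proof -
  from h(1) have "h \<in> (\<lambda>\<eta> x. cochain_eval \<eta> [x]) ` degree_part 1"
    using degree_part_1_dual by (auto simp: bij_betw_def)
  then obtain \<eta> where \<eta>: "\<eta> \<in> degree_part 1" and eval: "\<And>x. cochain_eval \<eta> [x] = h x"
    by auto
  have "\<eta> \<otimes> g \<in> degree_one_tensors"
    using \<eta> by (intro complex_vector.span_base) blast
  then have "t - \<eta> \<otimes> g = 0"
    using t by (intro degree_one_tensor_zero_if_contract_zero complex_vector.span_diff)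
      (simp_all add: contract_simps h(2) eval)
  with that[OF \<eta> eval] show ?thesis by simp
qed

lemma differential_zero_if_vanishes_on_brackets:
  fixes \<eta> :: "'n::complex_lie_algebra cochain"
  assumes "\<eta> \<in> degree_part 1" "\<And>x y. cochain_eval \<eta> [lie_bracket x y] = 0"
  shows "differential \<eta> = 0"
proof (rule cochain_eval_inject[THEN iffD1], rule ext)
  fix xs :: "'n list"
  have "differential \<eta> \<in> degree_part 2"
    using differential_degree_part[OF assms(1)] by (simp add: numeral_2_eq_2)
  then show "cochain_eval (differential \<eta>) xs = cochain_eval 0 xs"
    using assms(2)
    by (cases "length xs = 2")
      (auto simp: degree_part_cochain_def zero_cochain.rep_eq length_Suc_conv numeral_2_eq_2
        cochain_eval_differential_pair)
qed

text \<open>Both terms of the flatness equation vanish, the bracket because \<open>[g, g] = 0\<close>.\<close>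

lemma flat_connections1_subset:
  "flat_connections1 TYPE('n::complex_lie_algebra cochain) TYPE('g::complex_lie_algebra)
    \<subseteq> flat_connections TYPE('n cochain) TYPE('g)"
proof
  fix \<omega> :: "('n cochain, 'g) tensor" assume "\<omega> \<in> flat_connections1 TYPE('n cochain) TYPE('g)"
  then obtain \<eta> g where \<omega>: "\<omega> = \<eta> \<otimes> g" "\<eta> \<in> degree_part 1" "differential \<eta> = 0"
    by (auto simp: flat_connections1_def)
  have "\<omega> \<in> degree_one_tensors"
    using \<omega> by (intro complex_vector.span_base) blast
  moreover have "tensor_differential \<omega> + (1 / 2) *\<^sub>C tensor_bracket \<omega> \<omega> = 0"
    by (simp add: \<omega> tensor_differential_tensor tensor_bracket_tensor lie_bracket_self
        tensor_zero_left tensor_zero_right)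
  ultimately show "\<omega> \<in> flat_connections TYPE('n cochain) TYPE('g)"
    by (simp add: flat_connections_def)
qed

text \<open>
  Let \<open>\<phi>\<close> be the homomorphism attached to \<open>\<omega>\<close>, written as \<open>\<phi> x = h x \<cdot> \<phi> z\<close>. If
  \<open>\<phi> z \<noteq> 0\<close>, the coefficient \<open>h\<close> inherits linearity from \<open>\<phi>\<close>, so it is a form \<open>\<eta>\<close> of
  degree one with \<open>\<omega> = \<eta> \<otimes> \<phi> z\<close>. It is closed because it vanishes on brackets: the
  image of \<open>\<phi>\<close> is a line, hence abelian.
\<close>

lemma flat_connections_eq_if_homomorphisms_rank_one:
  assumes rank_one: "\<And>\<phi> :: 'n::complex_lie_algebra \<Rightarrow> 'g::complex_lie_algebra. clinear \<phi> \<Longrightarrow>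
      (\<And>x y. \<phi> (lie_bracket x y) = lie_bracket (\<phi> x) (\<phi> y)) \<Longrightarrow> \<exists>z. \<forall>x. \<exists>c. \<phi> x = c *\<^sub>C \<phi> z"
  shows "flat_connections TYPE('n cochain) TYPE('g) = flat_connections1 TYPE('n cochain) TYPE('g)"
proof (intro equalityI flat_connections1_subset subsetI)
  fix \<omega> :: "('n cochain, 'g) tensor" assume flat: "\<omega> \<in> flat_connections TYPE('n cochain) TYPE('g)"
  then have \<omega>: "\<omega> \<in> degree_one_tensors" by (simp add: flat_connections_def)
  define \<phi> where "\<phi> x = contract [x] \<omega>" for x
  have lin: "clinear \<phi>"
    unfolding \<phi>_def by (rule clinear_contract_vector[OF \<omega>])
  have hom: "\<phi> (lie_bracket x y) = lie_bracket (\<phi> x) (\<phi> y)" for x y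
    unfolding \<phi>_def by (rule flat_connection_homomorphism[OF flat])
  obtain z where "\<forall>x. \<exists>c. \<phi> x = c *\<^sub>C \<phi> z"
    using rank_one[OF lin hom] by blast
  then obtain h where h: "\<And>x. \<phi> x = h x *\<^sub>C \<phi> z" by metis
  show "\<omega> \<in> flat_connections1 TYPE('n cochain) TYPE('g)"
  proof (cases "\<phi> z = 0")
    case True
    then have "\<omega> = 0"
      using h by (intro degree_one_tensor_zero_if_contract_zero[OF \<omega>]) (simp add: \<phi>_def)
    also have "\<dots> = (0 :: 'n cochain) \<otimes> (0 :: 'g)"
      by (simp add: tensor_zero_left)
    finally show ?thesis
      using degree_part_zero differential_scale[of 0 "0 :: 'n cochain"]
      by (auto simp: flat_connections1_def)
  next
    case False
    have "clinear h"
    proof (rule clinearI)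
      fix x y c
      have "h (x + y) *\<^sub>C \<phi> z = (h x + h y) *\<^sub>C \<phi> z"
        by (simp only: complex_vector.scale_left_distrib h[symmetric] clinear_add[OF lin])
      with False show "h (x + y) = h x + h y" by simp
      have "h (c *\<^sub>C x) *\<^sub>C \<phi> z = (c * h x) *\<^sub>C \<phi> z"
        by (simp only: complex_vector.scale_scale[symmetric] h[symmetric] clinear_scale[OF lin])
      with False show "h (c *\<^sub>C x) = c *\<^sub>C h x" by (simp add: scaleC_complex_def)
    qed
    then obtain \<eta> where \<eta>: "\<eta> \<in> degree_part 1" "\<And>x. cochain_eval \<eta> [x] = h x" "\<omega> = \<eta> \<otimes> \<phi> z"
      using degree_one_tensor_eq_if_contract_rank_one[OF \<omega>, of h "\<phi> z"] h unfolding \<phi>_def by metis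
    have "h (lie_bracket x y) = 0" for x y
    proof -
      have "h (lie_bracket x y) *\<^sub>C \<phi> z = lie_bracket (h x *\<^sub>C \<phi> z) (h y *\<^sub>C \<phi> z)"
        by (simp only: h[symmetric] hom)
      also have "\<dots> = 0"
        by (simp add: lie_bracket_scale_left lie_bracket_scale_right lie_bracket_self)
      finally show ?thesis using False by simp
    qed
    then have "differential \<eta> = 0"
      using \<eta>(1,2) by (intro differential_zero_if_vanishes_on_brackets) simp_all
    with \<eta> show ?thesis by (auto simp: flat_connections1_def)
  qed
qed

corollary flat_connections_eq_if_traceless_representation:
  fixes \<rho> :: "'g::complex_lie_algebra \<Rightarrow> complex^2^2"
  assumes "nilpotent_lie_algebra TYPE('n::complex_lie_algebra)"
    and "clinear \<rho>" "inj \<rho>" "\<And>x. trace (\<rho> x) = 0"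
      "\<And>x y. \<rho> (lie_bracket x y) = commutator (\<rho> x) (\<rho> y)"
  shows "flat_connections TYPE('n cochain) TYPE('g) = flat_connections1 TYPE('n cochain) TYPE('g)"
  by (intro flat_connections_eq_if_homomorphisms_rank_one
      homomorphism_rank_one_if_traceless_representation[of \<rho>] assms)

theorem lemma4p14:
  assumes "finite_dimensional TYPE('n::complex_lie_algebra)"
    and "nilpotent_lie_algebra TYPE('n)"
  shows "flat_connections TYPE('n cochain) TYPE(sl2) = flat_connections1 TYPE('n cochain) TYPE(sl2)
    \<and> flat_connections TYPE('n cochain) TYPE(sol2) = flat_connections1 TYPE('n cochain) TYPE(sol2)"
proof
  show "flat_connections TYPE('n cochain) TYPE(sl2) = flat_connections1 TYPE('n cochain) TYPE(sl2)"
    by (rule flat_connections_eq_if_traceless_representation[OF assms(2), of Rep_sl2])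
      (use Rep_sl2 in \<open>auto simp: inj_def Rep_sl2_inject plus_sl2.rep_eq scaleC_sl2.rep_eq
        lie_bracket_sl2.rep_eq intro!: clinearI\<close>)
  show "flat_connections TYPE('n cochain) TYPE(sol2) = flat_connections1 TYPE('n cochain) TYPE(sol2)"
    by (rule flat_connections_eq_if_traceless_representation[OF assms(2), of Rep_sol2])
      (use Rep_sol2 in \<open>auto simp: inj_def Rep_sol2_inject plus_sol2.rep_eq scaleC_sol2.rep_eq
        lie_bracket_sol2.rep_eq intro!: clinearI\<close>)
qed

end
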